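(* Let $n,p$ be positive integers and let $\mathbf{K}_n^p\in\mathbf{U}(gl(n))$ be the rectangular Capelli-Deruyts bitableau with $p$ rows of length $n$. Let $v_\mu$ be a $gl(n,\mathbb{C})$-highest weight vector of weight $\mu=(\mu_1\ge\mu_2\ge\cdots\ge\mu_n)$ with $\mu_i\in\mathbb{N}$ for every $i=1,\dots,n$. Then $v_\mu$ is an eigenvector of the action of $\mathbf{K}_n^p$, namely $$\mathbf{K}_n^p\cdot v_\mu=(-1)^{\binom{p}{2}n}\left(\prod_{j=1}^{p}(\mu_1-j+n)(\mu_2-j+n-1)\cdots(\mu_n-j+1)\right)v_\mu .$$
   Context: $\mathbb{N}$ includes $0$. A highest weight vector of weight $\mu$ is a nonzero vector $v$ of a $gl(n)$-module with $e_{i,j}v=0$ for $i<j$ and $e_{i,i}v=\mu_i v$, where $e_{i,j}$ are the elementary matrices. Capelli bitableaux. Let $\mathcal{A}_0=\{\alpha_1,\dots,\alpha_{m}\}$ ($m$ sufficiently large) be a set of virtual symbols, with $|\alpha_s|=0\in\mathbb{Z}_2$, and $\mathcal{L}=\{1,\dots,n\}$ the proper symbols, with $|i|=1\in\mathbb{Z}_2$. Let $gl(m|n)$ be the complex Lie superalgebra with basis $e_{a,b}$, $a,b\in\mathcal{A}_0\cup\mathcal{L}$, of parity $|a|+|b|$, and superbracket $[e_{a,b},e_{c,d}]=\delta_{bc}e_{a,d}-(-1)^{(|a|+|b|)(|c|+|d|)}\delta_{ad}e_{c,b}$. The enveloping algebra $\mathbf{U}(gl(n))$ is the subalgebra of $\mathbf{U}(gl(m|n))$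 generated by the $e_{i,j}$, $i,j\in\mathcal{L}$. A product $e_{a_r,b_r}\cdots e_{a_1,b_1}$ is irregular if there are $i\le r$ and $\gamma\in\mathcal{A}_0$ with $\#\{j\le i: b_j=\gamma\}>\#\{j<i: a_j=\gamma\}$. Let $\mathbf{Irr}$ be the left ideal of $\mathbf{U}(gl(m|n))$ generated by the irregular products. It is known that $\mathbf{U}(gl(n))\cap\mathbf{Irr}=0$, that $Virt(m,n)=\mathbf{U}(gl(n))\oplus\mathbf{Irr}$ is a subalgebra, and that $\mathbf{Irr}$ is a two-sided ideal of it; the Capelli devirtualization epimorphism $\mathfrak{p}:Virt(m,n)\to\mathbf{U}(gl(n))$ is the projection with kernel $\mathbf{Irr}$. For Young tableaux $S=(s_{ij})$, $T=(t_{ij})$ of the same shape $\lambda=(\lambda_1\ge\dots\ge\lambda_p)$ with entries in $\mathcal{L}$, the Capelli bitableau is $$[S|T]=\mathfrak{p}\Big(\prod_{i=1}^{p}\big(e_{s_{i1},\alpha_i}e_{s_{i2},\alpha_i}\cdots e_{s_{i\lambda_i},\alpha_i}\big)\cdot\prod_{i=1}^{p}\big(e_{\alpha_i,t_{i1}}e_{\alpha_i,t_{i2}}\cdots e_{\alpha_i,t_{i\lambda_i}}\big)\Big),$$ with products ordered from left to right by increasing $i$ and $\alpha_1,\dots,\alpha_p$ distinct virtual symbols (the argument lies in $Virt(m,n)$ and the result does not depend on the choice of the $\alpha_i$). $\mathbf{K}_n^p=[S|T]$ where $S$ and $T$ have $p$ rows, every row of $S$ is $n\ (n-1)\ \cdots\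 2\ 1$ and every row of $T$ is $1\ 2\ \cdots\ n$. *)

theory Defs
  imports "HOL-Analysis.Analysis" "HOL-Library.Poly_Mapping"
begin

text \<open>Free monoid on \<open>'a\<close>. A separate type is used so that finitely supported functions on it
  carry the convolution product of the library, i.e. form the free associative algebra.\<close>

datatype 'a fmon = Fmon (letters: "'a list")

instantiation fmon :: (type) monoid_add
begin
definition zero_fmon :: "'a fmon" where "0 = Fmon []"
definition plus_fmon :: "'a fmon \<Rightarrow> 'a fmon \<Rightarrow> 'a fmon"
  where "x + y = Fmon (letters x @ letters y)"
instance by standard (simp_all add: zero_fmon_def plus_fmon_def)
end

inductive_set ideal_gen :: "'a::ring_1 set \<Rightarrow> 'a set" for S where
  zero: "0 \<in> ideal_gen S"
| gen: "x \<in> S \<Longrightarrow> a * x * b \<in> ideal_gen S"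
| add: "x \<in> ideal_gen S \<Longrightarrow> y \<in> ideal_gen S \<Longrightarrow> x + y \<in> ideal_gen S"

inductive_set left_ideal_gen :: "'a::ring_1 set \<Rightarrow> 'a set" for S where
  zero: "0 \<in> left_ideal_gen S"
| gen: "x \<in> S \<Longrightarrow> a * x \<in> left_ideal_gen S"
| add: "x \<in> left_ideal_gen S \<Longrightarrow> y \<in> left_ideal_gen S \<Longrightarrow> x + y \<in> left_ideal_gen S"

lemma ideal_gen_mult:
  assumes "x \<in> ideal_gen S" shows "c * x * d \<in> ideal_gen S"
  using assms
proof induction
  case (gen x a b)
  then show ?case using ideal_gen.gen[of x S "c * a" "b * d"] by (simp add: mult.assoc)
qed (auto simp: distrib_left distrib_right intro: ideal_gen.intros)

section \<open>The enveloping algebra of \<open>gl(m|n)\<close>\<close>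

text \<open>\<open>Inl\<close> embeds the virtual symbols (parity 0, \<open>m = CARD('m)\<close>), \<open>Inr\<close> the proper symbols
  (parity 1, \<open>n = CARD('n)\<close>). The pair \<open>(a, b)\<close> stands for the basis element \<open>e_{a,b}\<close>.\<close>

type_synonym ('m, 'n) gen = "('m + 'n) \<times> ('m + 'n)"
type_synonym ('m, 'n) free_alg = "('m, 'n) gen fmon \<Rightarrow>\<^sub>0 complex"

fun sym_parity :: "'m + 'n \<Rightarrow> nat" where
  "sym_parity (Inl _) = 0"
| "sym_parity (Inr _) = 1"

fun gen_parity :: "('m, 'n) gen \<Rightarrow> nat" where
  "gen_parity (a, b) = sym_parity a + sym_parity b"

definition free_gen :: "('m, 'n) gen \<Rightarrow> ('m, 'n) free_alg"
  where "free_gen x = Poly_Mapping.single (Fmon [x]) 1"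

fun free_bracket :: "('m, 'n) gen \<Rightarrow> ('m, 'n) gen \<Rightarrow> ('m, 'n) free_alg" where
  "free_bracket (a, b) (c, d) =
     (if b = c then free_gen (a, d) else 0)
     - (-1) ^ (gen_parity (a, b) * gen_parity (c, d)) * (if a = d then free_gen (c, b) else 0)"

definition env_ideal :: "('m, 'n) free_alg set" where
  "env_ideal = ideal_gen
     {free_gen x * free_gen y - (-1) ^ (gen_parity x * gen_parity y) * (free_gen y * free_gen x)
        - free_bracket x y | x y. True}"

lemma env_ideal_add: "x \<in> env_ideal \<Longrightarrow> y \<in> env_ideal \<Longrightarrow> x + y \<in> env_ideal"
  unfolding env_ideal_def by (rule ideal_gen.add)

lemma env_ideal_mult: "x \<in> env_ideal \<Longrightarrow> c * x * d \<in> env_ideal"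
  unfolding env_ideal_def by (rule ideal_gen_mult)

lemma env_ideal_zero: "0 \<in> env_ideal"
  unfolding env_ideal_def by (rule ideal_gen.zero)

lemma env_ideal_uminus: "x \<in> env_ideal \<Longrightarrow> - x \<in> env_ideal"
  using env_ideal_mult[of x "-1" 1] by simp

definition env_rel :: "('m, 'n) free_alg \<Rightarrow> ('m, 'n) free_alg \<Rightarrow> bool"
  where "env_rel x y \<longleftrightarrow> x - y \<in> env_ideal"

lemma equivp_env_rel: "equivp (env_rel :: ('m, 'n) free_alg \<Rightarrow> _)"
proof (rule equivpI)
  show "reflp (env_rel :: ('m, 'n) free_alg \<Rightarrow> _)" by (auto simp: reflp_def env_rel_def env_ideal_zero)
  show "symp (env_rel :: ('m, 'n) free_alg \<Rightarrow> _)"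
  proof (rule sympI)
    fix x y :: "('m, 'n) free_alg"
    assume "env_rel x y"
    then have "- (x - y) \<in> env_ideal" unfolding env_rel_def by (rule env_ideal_uminus)
    then show "env_rel y x" by (simp add: env_rel_def)
  qed
  show "transp (env_rel :: ('m, 'n) free_alg \<Rightarrow> _)"
  proof (rule transpI)
    fix x y z :: "('m, 'n) free_alg"
    assume "env_rel x y" "env_rel y z"
    then have "(x - y) + (y - z) \<in> env_ideal" unfolding env_rel_def by (rule env_ideal_add)
    then show "env_rel x z" by (simp add: env_rel_def)
  qed
qed

quotient_type ('m, 'n) env = "('m, 'n) free_alg" / env_rel
  by (rule equivp_env_rel)

text \<open>The constant coefficient vanishes on the ideal, so the quotient is not the zero ring.\<close>

lemma lookup_mult_fmon_zero:
  fixes x y :: "'a fmon \<Rightarrow>\<^sub>0 complex"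
  shows "Poly_Mapping.lookup (x * y) 0 = Poly_Mapping.lookup x 0 * Poly_Mapping.lookup y 0"
proof -
  have eq: "(k + l = 0) \<longleftrightarrow> k = 0 \<and> l = 0" for k l :: "'a fmon"
    by (cases k; cases l) (auto simp: zero_fmon_def plus_fmon_def)
  have inner: "(\<Sum>q. Poly_Mapping.lookup y q when l + q = 0) = (Poly_Mapping.lookup y 0 when l = 0)" for l
    by (cases "l = 0") (simp_all add: eq)
  show ?thesis
    by (simp add: lookup_mult eq_commute[of 0] inner mult_when)
qed

lemma env_ideal_lookup_zero:
  fixes x :: "('m, 'n) free_alg"
  shows "x \<in> env_ideal \<Longrightarrow> Poly_Mapping.lookup x 0 = 0"
  unfolding env_ideal_def
proof (induction rule: ideal_gen.induct)
  case (gen x a b)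
  have free: "Poly_Mapping.lookup (free_gen y) 0 = 0" for y :: "('m, 'n) gen"
    by (simp add: free_gen_def lookup_single zero_fmon_def)
  have bracket: "Poly_Mapping.lookup (free_bracket (a, b) (c, d)) 0 = 0"
    for a b c d :: "'m + 'n"
    unfolding free_bracket.simps lookup_minus lookup_mult_fmon_zero
    by (cases "b = c"; cases "a = d") (simp_all only: simp_thms free if_True if_False lookup_zero mult_zero_right diff_self)
  from gen obtain y z :: "('m, 'n) gen" where
    x: "x = free_gen y * free_gen z - (-1) ^ (gen_parity y * gen_parity z) * (free_gen z * free_gen y)
          - free_bracket y z"
    by blast
  have "Poly_Mapping.lookup (free_bracket y z) 0 = 0"
    using bracket by (cases y; cases z) blast
  then have "Poly_Mapping.lookup x 0 = 0"
    unfolding x lookup_minus lookup_mult_fmon_zero free by simp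
  then show ?case by (simp add: lookup_mult_fmon_zero)
qed (simp_all add: lookup_add)

instantiation env :: (type, type) ring_1
begin

lift_definition zero_env :: "('a, 'b) env" is 0 .
lift_definition one_env :: "('a, 'b) env" is 1 .
lift_definition plus_env :: "('a, 'b) env \<Rightarrow> ('a, 'b) env \<Rightarrow> ('a, 'b) env" is "(+)"
  unfolding env_rel_def add_diff_add by (rule env_ideal_add)
lift_definition uminus_env :: "('a, 'b) env \<Rightarrow> ('a, 'b) env" is uminus
  unfolding env_rel_def minus_diff_minus by (rule env_ideal_uminus)
lift_definition minus_env :: "('a, 'b) env \<Rightarrow> ('a, 'b) env \<Rightarrow> ('a, 'b) env" is "(-)"
proof -
  fix x x' y y' :: "('a, 'b) free_alg"
  assume "env_rel x x'" "env_rel y y'"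
  then have "(x - x') + - (y - y') \<in> env_ideal"
    unfolding env_rel_def by (intro env_ideal_add env_ideal_uminus)
  then show "env_rel (x - y) (x' - y')" unfolding env_rel_def by (simp add: algebra_simps)
qed
lift_definition times_env :: "('a, 'b) env \<Rightarrow> ('a, 'b) env \<Rightarrow> ('a, 'b) env" is "(*)"
proof -
  fix x x' y y' :: "('a, 'b) free_alg"
  assume "env_rel x x'" "env_rel y y'"
  then have "1 * (x - x') * y + x' * (y - y') * 1 \<in> env_ideal"
    unfolding env_rel_def by (intro env_ideal_add env_ideal_mult)
  then show "env_rel (x * y) (x' * y')" unfolding env_rel_def by (simp add: algebra_simps)
qed

instance
proof
  have "(0 :: ('a, 'b) free_alg) - 1 \<notin> env_ideal"
  proof
    assume "(0 :: ('a, 'b) free_alg) - 1 \<in> env_ideal"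
    from env_ideal_lookup_zero[OF this] show False by (simp add: lookup_minus)
  qed
  then show "(0 :: ('a, 'b) env) \<noteq> 1"
    unfolding zero_env_def one_env_def env.abs_eq_iff env_rel_def .
next
  fix a b c :: "('a,'b) env"
  show "a * b * c = a * (b * c)" by transfer (simp add: env_rel_def env_ideal_zero mult.assoc)
  show "1 * a = a" by transfer (simp add: env_rel_def env_ideal_zero)
  show "a * 1 = a" by transfer (simp add: env_rel_def env_ideal_zero)
  show "a + b + c = a + (b + c)" by transfer (simp add: env_rel_def env_ideal_zero add.assoc)
  show "a + b = b + a" by transfer (simp add: env_rel_def env_ideal_zero add.commute)
  show "0 + a = a" by transfer (simp add: env_rel_def env_ideal_zero)
  show "- a + a = 0" by transfer (simp add: env_rel_def env_ideal_zero)
  show "a - b = a + - b" by transfer (simp add: env_rel_def env_ideal_zero)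
  show "(a + b) * c = a * c + b * c" by transfer (simp add: env_rel_def env_ideal_zero distrib_right)
  show "a * (b + c) = a * b + a * c" by transfer (simp add: env_rel_def env_ideal_zero distrib_left)
qed

end

lift_definition env_scalar :: "complex \<Rightarrow> ('m, 'n) env" is "Poly_Mapping.single 0" .

lift_definition env_gen :: "'m + 'n \<Rightarrow> 'm + 'n \<Rightarrow> ('m, 'n) env" is "\<lambda>a b. free_gen (a, b)" .

inductive_set env_gl :: "('m, 'n) env set" where
  scalar: "env_scalar c \<in> env_gl"
| gen: "env_gen (Inr i) (Inr j) \<in> env_gl"
| add: "x \<in> env_gl \<Longrightarrow> y \<in> env_gl \<Longrightarrow> x + y \<in> env_gl"
| mult: "x \<in> env_gl \<Longrightarrow> y \<in> env_gl \<Longrightarrow> x * y \<in> env_gl"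


section \<open>Devirtualization and Capelli bitableaux\<close>

definition env_word :: "('m, 'n) gen list \<Rightarrow> ('m, 'n) env"
  where "env_word w = prod_list (map (\<lambda>(a, b). env_gen a b) w)"

text \<open>Words are listed from left to right, but irregularity counts factors from the right:
  the \<open>j\<close>-th factor, for \<open>1 \<le> j \<le> length w\<close>, is \<open>w ! (length w - j)\<close>.\<close>

definition irregular :: "('m, 'n) gen list \<Rightarrow> bool" where
  "irregular w \<longleftrightarrow> (\<exists>i\<in>{1..length w}. \<exists>\<gamma>.
     card {j\<in>{1..i}. snd (w ! (length w - j)) = Inl \<gamma>}
       > card {j\<in>{1..<i}. fst (w ! (length w - j)) = Inl \<gamma>})"

definition Irr :: "('m, 'n) env set"
  where "Irr = left_ideal_gen (env_word ` {w. irregular w})"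

text \<open>The projection of \<open>env_gl \<oplus> Irr\<close> onto the first summand; only meaningful there.\<close>

definition devirt :: "('m, 'n) env \<Rightarrow> ('m, 'n) env"
  where "devirt x = (THE u. u \<in> env_gl \<and> x - u \<in> Irr)"

text \<open>Tableaux are lists of rows; the virtual symbol attached to the \<open>i\<close>-th row is the
  \<open>i\<close>-th entry of \<open>alphas\<close>.\<close>

definition capelli_bitableau :: "'m list \<Rightarrow> 'n list list \<Rightarrow> 'n list list \<Rightarrow> ('m, 'n) env" where
  "capelli_bitableau alphas S T = devirt
     (env_word (concat (map2 (\<lambda>a row. map (\<lambda>s. (Inr s, Inl a)) row) alphas S))
      * env_word (concat (map2 (\<lambda>a row. map (\<lambda>t. (Inl a, Inr t)) row) alphas T)))"

text \<open>The proper symbols \<open>1, \<dots>, n\<close> are the elements of \<open>'n\<close> in increasing order.\<close>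

definition capelli_deruyts :: "'m list \<Rightarrow> nat \<Rightarrow> ('m, 'n::{finite,linorder}) env" where
  "capelli_deruyts alphas p = capelli_bitableau alphas
     (replicate p (rev (sorted_list_of_set UNIV))) (replicate p (sorted_list_of_set UNIV))"

definition pos :: "'n::{finite,linorder} \<Rightarrow> nat"
  where "pos i = card {..i}"


section \<open>Modules over \<open>gl(n, \<complex>)\<close>\<close>

locale gl_module = vector_space smul
  for smul :: "complex \<Rightarrow> 'v::ab_group_add \<Rightarrow> 'v" +
  fixes rho :: "complex ^ 'n ^ 'n::finite \<Rightarrow> 'v \<Rightarrow> 'v"
  assumes rho_linear: "Vector_Spaces.linear smul smul (rho A)"
    and rho_add: "rho (A + B) v = rho A v + rho B v"
    and rho_scale: "rho (\<chi> i j. c * A $ i $ j) v = smul c (rho A v)"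
    and rho_bracket: "rho (A ** B - B ** A) v = rho A (rho B v) - rho B (rho A v)"

definition elem_mat :: "'n::finite \<Rightarrow> 'n \<Rightarrow> complex ^ 'n ^ 'n"
  where "elem_mat i j = axis i (axis j 1)"

definition highest_weight_vector ::
  "(complex \<Rightarrow> 'v::ab_group_add \<Rightarrow> 'v)
    \<Rightarrow> (complex ^ 'n::{finite,linorder} ^ 'n::{finite,linorder} \<Rightarrow> 'v \<Rightarrow> 'v)
    \<Rightarrow> ('n::{finite,linorder} \<Rightarrow> complex) \<Rightarrow> 'v \<Rightarrow> bool" where
  "highest_weight_vector smul rho mu v \<longleftrightarrow> v \<noteq> 0 \<and>
     (\<forall>i j. i < j \<longrightarrow> rho (elem_mat i j) v = 0) \<and>
     (\<forall>i. rho (elem_mat i i) v = smul (mu i) v)"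

text \<open>\<open>Phi\<close> restricts to a unital algebra homomorphism from \<open>env_gl\<close> to the endomorphisms of the
  module that extends \<open>rho\<close>; its values outside \<open>env_gl\<close> are irrelevant.\<close>

definition extends_to_env_gl ::
  "(complex \<Rightarrow> 'v::ab_group_add \<Rightarrow> 'v) \<Rightarrow> (complex ^ 'n ^ 'n \<Rightarrow> 'v \<Rightarrow> 'v)
    \<Rightarrow> (('m, 'n::finite) env \<Rightarrow> 'v \<Rightarrow> 'v) \<Rightarrow> bool" where
  "extends_to_env_gl smul rho Phi \<longleftrightarrow>
     (\<forall>x\<in>env_gl. Vector_Spaces.linear smul smul (Phi x)) \<and>
     (\<forall>c v. Phi (env_scalar c) v = smul c v) \<and>
     (\<forall>i j v. Phi (env_gen (Inr i) (Inr j)) v = rho (elem_mat i j) v) \<and>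
     (\<forall>x\<in>env_gl. \<forall>y\<in>env_gl. \<forall>v. Phi (x + y) v = Phi x v + Phi y v) \<and>
     (\<forall>x\<in>env_gl. \<forall>y\<in>env_gl. \<forall>v. Phi (x * y) v = Phi x (Phi y v))"

definition env_gl_act ::
  "(complex \<Rightarrow> 'v::ab_group_add \<Rightarrow> 'v) \<Rightarrow> (complex ^ 'n ^ 'n \<Rightarrow> 'v \<Rightarrow> 'v)
    \<Rightarrow> ('m, 'n::finite) env \<Rightarrow> 'v \<Rightarrow> 'v" where
  "env_gl_act smul rho x v = (THE w. \<exists>Phi. extends_to_env_gl smul rho Phi \<and> w = Phi x v)"

end

theory Submission
  imports Defs "HOL-Library.Function_Algebras"
begin

text \<open>
  Both devirtualization and the action of the enveloping algebra of \<open>gl(n)\<close> are controlled by one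
  construction. Let \<open>V\<close> be a \<open>gl(n)\<close>-module. The exterior algebra in odd variables \<open>x_{\<alpha>,i}\<close>, one for
  each pair of a virtual and a proper symbol, with coefficients in \<open>V\<close>, is a module over
  \<open>gl(m|n)\<close>, the Kac module of \<open>V\<close> (\<open>kac_bracket\<close>): \<open>e_{\<alpha>,i}\<close> multiplies by \<open>x_{\<alpha>,i}\<close>, and the generators
  \<open>e_{a,\<alpha>}\<close> with \<open>\<alpha>\<close> virtual annihilate the constants \<open>V\<close>. Counting variables shows that every irregular
  word annihilates \<open>V\<close> (\<open>Irr_kills\<close>).

  This has three consequences. First, with the enveloping algebra as \<open>V\<close>, the subalgebra \<open>env_gl\<close>
  meets \<open>Irr\<close> only in \<open>0\<close> (\<open>env_gl_Irr_zero\<close>). As a bitableau word lies in \<open>env_gl + Irr\<close>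
  (\<open>balanced_word_decomposition\<close>), its devirtualization is well defined. Secondly, the action of \<open>gl(n)\<close>
  on an arbitrary \<open>V\<close> extends to \<open>env_gl\<close> (\<open>env_gl_act_eq\<close>). Thirdly, a bitableau acts on \<open>V\<close> as its
  virtual word does in the Kac module, so the devirtualization need not be computed.

  It remains to apply the virtual word of the Capelli-Deruyts bitableau to a highest weight vector
  \<open>v\<close>. The right half creates the monomial in all \<open>x_{\<alpha>,i}\<close> of the \<open>p\<close> rows. The left half removes the
  variables one at a time, starting with the last row and in the order \<open>1, \<dots>, n\<close>. In this order
  each \<open>e_{i,\<alpha>}\<close> acts as differentiation by \<open>x_{\<alpha>,i}\<close> times a scalar, and while \<open>j\<close> rows remain the scalar is
  \<open>\<mu>_i - j + n - i + 1\<close> (\<open>lowering_occupied\<close>). The product of these scalars is the eigenvalue, and the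
  sign comes from moving each row of derivatives past the other rows (\<open>lowerings_creations\<close>).
\<close>

section \<open>The ring of additive operators\<close>

text \<open>Operators on a module form a ring, and with a type for them the superbracket relations below
  become identities between ring elements. No \<open>ring_1\<close> instance is possible, because on the zero
  module \<open>0 = 1\<close>.\<close>

typedef (overloaded) 'v endo = "{f :: 'v::ab_group_add \<Rightarrow> 'v. \<forall>x y. f (x + y) = f x + f y}"
  morphisms app Endo
  by (rule exI[of _ "\<lambda>x. x"]) simp

setup_lifting type_definition_endo

instantiation endo :: (ab_group_add) "{ring, monoid_mult}"
begin

lift_definition zero_endo :: "'a endo" is "\<lambda>_. 0" by simp
lift_definition one_endo :: "'a endo" is "\<lambda>x. x" by simp
lift_definition plus_endo :: "'a endo \<Rightarrow> 'a endo \<Rightarrow> 'a endo" is "\<lambda>f g x. f x + g x"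
  by (simp add: algebra_simps)
lift_definition minus_endo :: "'a endo \<Rightarrow> 'a endo \<Rightarrow> 'a endo" is "\<lambda>f g x. f x - g x"
  by (simp add: algebra_simps)
lift_definition uminus_endo :: "'a endo \<Rightarrow> 'a endo" is "\<lambda>f x. - f x"
  by simp
lift_definition times_endo :: "'a endo \<Rightarrow> 'a endo \<Rightarrow> 'a endo" is "\<lambda>f g x. f (g x)"
  by simp

instance
  by standard (transfer; simp add: algebra_simps fun_eq_iff)+

end

lemma endo_eqI: "(\<And>x. app A x = app B x) \<Longrightarrow> A = B"
  by (metis app_inject ext)

lemma app_add_right: "app A (x + y) = app A x + app A y"
  by transfer simp

lemma additive_app: "Modules.additive (app A)"
  by (rule Modules.additive.intro) (rule app_add_right)

lemmas app_arith_right =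
  Modules.additive.zero[OF additive_app] Modules.additive.minus[OF additive_app]
  Modules.additive.diff[OF additive_app] Modules.additive.sum[OF additive_app]

lemma app_arith [simp]:
  "app 0 x = 0" "app 1 x = x" "app (A + B) x = app A x + app B x"
  "app (A - B) x = app A x - app B x" "app (- A) x = - app A x" "app (A * B) x = app A (app B x)"
  by (transfer; simp)+

lemma app_sum: "app (sum F A) x = (\<Sum>i\<in>A. app (F i) x)"
  by (induction A rule: infinite_finite_induct) auto

section \<open>Fermionic creation and annihilation operators\<close>

text \<open>Signs are written as a flag rather than as a power of \<open>-1\<close>, since the ring of operators has
  no numerals; the same function serves in modules, in operator rings and in the enveloping algebra.\<close>

definition flip :: "bool \<Rightarrow> 'v::ab_group_add \<Rightarrow> 'v"
  where "flip b x = (if b then - x else x)"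

text \<open>A function on the subsets of a finite type \<open>'s\<close> is an element of the exterior algebra on \<open>'s\<close>
  with coefficients in \<open>'v\<close>: the value at \<open>S\<close> is the coefficient of the product of the elements
  of \<open>S\<close> in increasing order. The order is the one of an arbitrary enumeration, and multiplying a
  monomial by \<open>a\<close> from the left costs one sign for each factor below \<open>a\<close>.\<close>

definition odd_below :: "'s::finite \<Rightarrow> 's set \<Rightarrow> bool"
  where "odd_below a S \<longleftrightarrow> odd (card {b\<in>S. to_nat b < to_nat a})"

lemma odd_below_insert:
  assumes "b \<notin> S"
  shows "odd_below a (insert b S) \<longleftrightarrow> (odd_below a S \<noteq> (to_nat b < to_nat a))"
proof -
  have "{c \<in> insert b S. to_nat c < to_nat a} =
      (if to_nat b < to_nat a then insert b {c\<in>S. to_nat c < to_nat a} else {c\<in>S. to_nat c < to_nat a})"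
    by auto
  with assms show ?thesis by (simp add: odd_below_def)
qed

lemma odd_below_remove:
  assumes "b \<in> S"
  shows "odd_below a (S - {b}) \<longleftrightarrow> (odd_below a S \<noteq> (to_nat b < to_nat a))"
  using odd_below_insert[of b "S - {b}" a] assms by (auto simp: insert_absorb)

lift_definition cre :: "'s::finite \<Rightarrow> ('s set \<Rightarrow> 'v::ab_group_add) endo" is
  "\<lambda>a f S. if a \<in> S then flip (odd_below a S) (f (S - {a})) else 0"
  by (auto simp: flip_def fun_eq_iff)

lift_definition ann :: "'s::finite \<Rightarrow> ('s set \<Rightarrow> 'v::ab_group_add) endo" is
  "\<lambda>a f S. if a \<in> S then 0 else flip (odd_below a S) (f (insert a S))"
  by (auto simp: flip_def fun_eq_iff)

lemma to_nat_neq_cases: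
  assumes "a \<noteq> (b :: 's::countable)"
  obtains "to_nat a < to_nat b" "\<not> to_nat b < to_nat a" | "to_nat b < to_nat a" "\<not> to_nat a < to_nat b"
  using assms by (metis linorder_neqE_nat order_less_asym to_nat_split)

lemma cre_cre: "cre a * cre b = - (cre b * cre a)"
proof (rule endo_eqI, rule ext)
  fix f :: "'a set \<Rightarrow> 'b" and S
  show "app (cre a * cre b) f S = app (- (cre b * cre a)) f S"
  proof (cases "a = b")
    case True
    then show ?thesis by (simp add: cre.rep_eq flip_def)
  next
    case False
    have "S - {a} - {b} = S - {b} - {a}" by auto
    with False show ?thesis
      by (elim to_nat_neq_cases) (auto simp: cre.rep_eq flip_def odd_below_remove)
  qed
qed

lemma ann_ann: "ann a * ann b = - (ann b * ann a)"
proof (rule endo_eqI, rule ext)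
  fix f :: "'a set \<Rightarrow> 'b" and S
  show "app (ann a * ann b) f S = app (- (ann b * ann a)) f S"
  proof (cases "a = b")
    case True
    then show ?thesis by (simp add: ann.rep_eq flip_def)
  next
    case False
    have "insert a (insert b S) = insert b (insert a S)" by auto
    with False show ?thesis
      by (elim to_nat_neq_cases) (auto simp: ann.rep_eq flip_def odd_below_insert)
  qed
qed

text \<open>With the two anticommutation rules above, the canonical anticommutation relations. The proof
  that the Kac module below satisfies the superbracket relations uses only these and
  the commutation of \<open>cre\<close> and \<open>ann\<close> with maps of the coefficients, so the ordering of \<open>'s\<close> does not enter it.\<close>

lemma ann_cre: "ann a * cre b = (if a = b then 1 else 0) - cre b * ann a"
proof (rule endo_eqI, rule ext)
  fix f :: "'a set \<Rightarrow> 'b" and S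
  show "app (ann a * cre b) f S = app ((if a = b then 1 else 0) - cre b * ann a) f S"
  proof (cases "a = b")
    case True
    then show ?thesis
      by (auto simp: ann.rep_eq cre.rep_eq flip_def odd_below_insert odd_below_remove insert_absorb)
  next
    case False
    then have "insert a S - {b} = insert a (S - {b})" by auto
    with False show ?thesis
      by (elim to_nat_neq_cases)
        (auto simp: ann.rep_eq cre.rep_eq flip_def odd_below_insert odd_below_remove)
  qed
qed

text \<open>A map of the coefficients gives an operator only if it is additive; the value \<open>0\<close> in the other
  case makes the definition total.\<close>

lift_definition coeffwise :: "('v \<Rightarrow> 'v) \<Rightarrow> ('s::finite set \<Rightarrow> 'v::ab_group_add) endo" is
  "\<lambda>h f. if Modules.additive h then (\<lambda>S. h (f S)) else 0"
  by (auto simp: fun_eq_iff Modules.additive.add)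

lemma coeffwise_app: "Modules.additive h \<Longrightarrow> app (coeffwise h) f S = h (f S)"
  by transfer simp

lemma coeffwise_comm:
  assumes "Modules.additive h"
  shows "coeffwise h * cre a = cre a * coeffwise h" "coeffwise h * ann a = ann a * coeffwise h"
  using assms by (auto intro!: endo_eqI ext
      simp: coeffwise_app cre.rep_eq ann.rep_eq flip_def Modules.additive.minus Modules.additive.zero)

definition vac :: "'v \<Rightarrow> ('s::finite set \<Rightarrow> 'v::ab_group_add)"
  where "vac v S = (if S = {} then v else 0)"

lemma ann_vac: "app (ann a) (vac v) = 0"
  by (auto simp: ann.rep_eq vac_def flip_def fun_eq_iff)

lemma coeffwise_vac: "Modules.additive h \<Longrightarrow> app (coeffwise h) (vac v) = vac (h v)"
  by (auto simp: coeffwise_app vac_def fun_eq_iff Modules.additive.zero)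

section \<open>The Kac module of a representation of gl(n)\<close>

lemma sum_prod_delta:
  fixes F :: "'a::finite \<Rightarrow> 'r::comm_monoid_add"
  shows "(\<Sum>k\<in>UNIV. if P \<and> k = i then F k else 0) = (if P then F i else 0)"
    "(\<Sum>k\<in>UNIV. if k = i \<and> P then F k else 0) = (if P then F i else 0)"
  by (cases P; simp add: sum.delta)+

lemma delta_mult:
  fixes x y :: "'r::mult_zero"
  shows "(if P then x else 0) * y = (if P then x * y else 0)"
    "y * (if P then x else 0) = (if P then y * x else 0)"
  by auto

definition comm :: "'r::ring \<Rightarrow> 'r \<Rightarrow> 'r"
  where "comm A B = A * B - B * A"

lemma comm_mult_right: "comm A (B * C) = comm A B * C + B * comm A C"
  and comm_sum_right: "comm A (\<Sum>i\<in>I. F i) = (\<Sum>i\<in>I. comm A (F i))"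
  and comm_sum_left: "comm (\<Sum>i\<in>I. F i) A = (\<Sum>i\<in>I. comm (F i) A)"
  and comm_diff_right: "comm A (B - C) = comm A B - comm A C"
  and comm_diff_left: "comm (A - B) C = comm A C - comm B C"
  and comm_swap: "comm B A = - comm A B"
  by (simp_all add: comm_def algebra_simps sum_subtractf sum_distrib_left sum_distrib_right)

lemma comm_number_cre: "comm (cre b * ann a) (cre c) = (if a = c then cre b else 0)"
proof -
  have "comm (cre b * ann a) (cre c) = cre b * (ann a * cre c) - (cre c * cre b) * ann a"
    by (simp add: comm_def mult.assoc)
  also have "\<dots> = (if a = c then cre b else 0)"
    unfolding ann_cre cre_cre[of c b] by (auto simp: algebra_simps)
  finally show ?thesis .
qed

lemma comm_number_ann: "comm (cre b * ann a) (ann c) = (if b = c then - ann a else 0)"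
proof -
  have "comm (cre b * ann a) (ann c) = cre b * (ann a * ann c) - (ann c * cre b) * ann a"
    by (simp add: comm_def mult.assoc)
  also have "\<dots> = (if b = c then - ann a else 0)"
    unfolding ann_cre ann_ann[of a c] by (auto simp: algebra_simps)
  finally show ?thesis .
qed

text \<open>A representation of \<open>gl(n)\<close> given by the operators of the elementary matrices. Two instances
  matter: the module of the theorem, and the enveloping algebra acting on itself by left
  multiplication.\<close>

locale gl_rep = vector_space scal
  for scal :: "complex \<Rightarrow> 'v::ab_group_add \<Rightarrow> 'v" +
  fixes E :: "'n::finite \<Rightarrow> 'n \<Rightarrow> 'v \<Rightarrow> 'v"
  assumes E_linear: "Vector_Spaces.linear scal scal (E i j)"
    and E_bracket: "E i j (E k l x) - E k l (E i j x) =
      (if j = k then E i l x else 0) - (if i = l then E k j x else 0)"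
begin

lemma additive_E: "Modules.additive (E i j)"
  using E_linear[THEN Vector_Spaces.linear.axioms(3)] by (auto intro: Modules.additive.intro module_hom.add)

lemma E_scal: "E i j (scal c x) = scal c (E i j x)"
  using E_linear[THEN Vector_Spaces.linear.axioms(3)] by (rule module_hom.scale)

lemma additive_scal: "Modules.additive (scal c)"
  by (simp add: Modules.additive_def scale_right_distrib)

definition coeff_E :: "'n \<Rightarrow> 'n \<Rightarrow> ('s::finite set \<Rightarrow> 'v) endo"
  where "coeff_E i j = coeffwise (E i j)"

definition scalar :: "complex \<Rightarrow> ('s::finite set \<Rightarrow> 'v) endo"
  where "scalar c = coeffwise (scal c)"

lemma app_scalar: "app (scalar c) f S = scal c (f S)"
  by (simp add: scalar_def coeffwise_app additive_scal)

lemma app_coeff_E: "app (coeff_E i j) f S = E i j (f S)"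
  by (simp add: coeff_E_def coeffwise_app additive_E)

lemma scalar_0 [simp]: "scalar 0 = 0" and scalar_1 [simp]: "scalar 1 = 1"
  and scalar_add: "scalar (c + d) = scalar c + scalar d"
  and scalar_uminus: "scalar (- c) = - scalar c"
  and scalar_mult: "scalar (c * d) = scalar c * scalar d"
  by (auto intro!: endo_eqI ext simp: app_scalar scale_left_distrib)

lemma coeff_E_cre: "comm (coeff_E i j) (cre a) = 0"
  and coeff_E_ann: "comm (coeff_E i j) (ann a) = 0"
  by (simp_all add: coeff_E_def comm_def coeffwise_comm additive_E)

lemma scalar_cre: "scalar c * cre a = cre a * scalar c"
  and scalar_ann: "scalar c * ann a = ann a * scalar c"
  by (simp_all add: scalar_def coeffwise_comm additive_scal)

lemma scalar_coeff_E: "scalar c * coeff_E i j = coeff_E i j * scalar c"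
  by (auto intro!: endo_eqI ext simp: app_scalar app_coeff_E E_scal)

lemma number_coeff_E: "comm (cre b * ann a) (coeff_E i j) = 0"
  using coeff_E_cre[of i j b] coeff_E_ann[of i j a]
  unfolding comm_def right_minus_eq by (metis mult.assoc)

lemma comm_coeff_E:
  "comm (coeff_E i j) (coeff_E k l :: ('s::finite set \<Rightarrow> 'v) endo) =
     (if j = k then coeff_E i l else 0) - (if i = l then coeff_E k j else 0)"
proof (rule endo_eqI, rule ext)
  fix f :: "'s set \<Rightarrow> 'v" and S
  show "app (comm (coeff_E i j) (coeff_E k l)) f S =
      app ((if j = k then coeff_E i l else 0) - (if i = l then coeff_E k j else 0)) f S"
    using E_bracket[of i j k l "f S"] by (simp add: comm_def app_coeff_E)
qed

text \<open>The next three operators, together with the creation operators, are the basis elements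
  \<open>e_{i,j}\<close>, \<open>e_{\<alpha>,\<beta>}\<close> and \<open>e_{i,\<alpha>}\<close> of \<open>gl(m|n)\<close> on the Kac module, that is, on the module induced
  from \<open>V\<close>, on which \<open>gl(m)\<close> acts by zero and which all \<open>e_{i,\<alpha>}\<close> annihilate. The even ones act as
  derivations on the odd variables \<open>x_{\<alpha>,i}\<close>: the virtual index of a variable is a vector index
  and the proper one a covector index, hence the minus sign in \<open>proper_op\<close>. The form of
  \<open>lowering_op\<close> results from moving \<open>e_{i,\<alpha>}\<close> past the variables by means of the superbracket
  until it reaches \<open>V\<close>.\<close>

definition proper_op :: "'n \<Rightarrow> 'n \<Rightarrow> (('m::finite \<times> 'n) set \<Rightarrow> 'v) endo"
  where "proper_op i j = coeff_E i j - (\<Sum>\<gamma>\<in>UNIV. cre (\<gamma>, j) * ann (\<gamma>, i))"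

definition virtual_op :: "'m::finite \<Rightarrow> 'm \<Rightarrow> (('m \<times> 'n) set \<Rightarrow> 'v) endo"
  where "virtual_op \<alpha> \<beta> = (\<Sum>k\<in>UNIV. cre (\<alpha>, k) * ann (\<beta>, k))"

definition lowering_op :: "'n \<Rightarrow> 'm::finite \<Rightarrow> (('m \<times> 'n) set \<Rightarrow> 'v) endo"
  where "lowering_op i \<alpha> = (\<Sum>k\<in>UNIV. proper_op i k * ann (\<alpha>, k))"

lemma proper_cre: "comm (proper_op i j) (cre (\<gamma>, k)) = (if i = k then - cre (\<gamma>, j) else 0)"
  by (simp add: proper_op_def comm_diff_left comm_sum_left coeff_E_cre comm_number_cre sum_prod_delta)

lemma proper_ann: "comm (proper_op i j) (ann (\<gamma>, k)) = (if j = k then ann (\<gamma>, i) else 0)"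
proof -
  have "(\<Sum>\<delta>\<in>UNIV. if \<delta> = \<gamma> \<and> j = k then - ann (\<delta>, i) else 0) = (if j = k then - ann (\<gamma>, i) else 0)"
    by (rule sum_prod_delta)
  then show ?thesis
    by (simp add: proper_op_def comm_diff_left comm_sum_left coeff_E_ann comm_number_ann)
qed

lemma virtual_cre: "comm (virtual_op \<alpha> \<beta>) (cre (\<gamma>, i)) = (if \<beta> = \<gamma> then cre (\<alpha>, i) else 0)"
  by (simp add: virtual_op_def comm_sum_left comm_number_cre sum_prod_delta)

lemma virtual_ann: "comm (virtual_op \<alpha> \<beta>) (ann (\<gamma>, i)) = (if \<alpha> = \<gamma> then - ann (\<beta>, i) else 0)"
proof -
  have "(\<Sum>k\<in>UNIV. if \<alpha> = \<gamma> \<and> k = i then - ann (\<beta>, k) else 0) = (if \<alpha> = \<gamma> then - ann (\<beta>, i) else 0)"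
    by (rule sum_prod_delta)
  then show ?thesis
    by (simp add: virtual_op_def comm_sum_left comm_number_ann)
qed

lemma proper_proper:
  fixes i j k l :: 'n
  shows "comm (proper_op i j) (proper_op k l :: (('m::finite \<times> 'n) set \<Rightarrow> 'v) endo) =
     (if j = k then proper_op i l else 0) - (if i = l then proper_op k j else 0)"
proof -
  have "comm (proper_op i j) (coeff_E k l :: (('m \<times> 'n) set \<Rightarrow> 'v) endo) = comm (coeff_E i j) (coeff_E k l)"
    by (simp add: proper_op_def comm_diff_left comm_sum_left number_coeff_E)
  moreover have "comm (proper_op i j) (proper_op k l :: (('m \<times> 'n) set \<Rightarrow> 'v) endo) = comm (proper_op i j) (coeff_E k l)
      - comm (proper_op i j) (\<Sum>\<gamma>\<in>UNIV. cre (\<gamma>, l) * ann (\<gamma>, k))"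
    unfolding proper_op_def[of k l] by (rule comm_diff_right)
  moreover have "comm (proper_op i j) (\<Sum>\<gamma>\<in>(UNIV :: 'm set). cre (\<gamma>, l) * ann (\<gamma>, k)) =
      (if j = k then \<Sum>\<gamma>\<in>UNIV. cre (\<gamma>, l) * ann (\<gamma>, i) else 0)
      - (if i = l then \<Sum>\<gamma>\<in>UNIV. cre (\<gamma>, j) * ann (\<gamma>, k) else 0)"
    by (simp add: comm_sum_right comm_mult_right proper_cre proper_ann delta_mult sum.distrib sum_negf)
  ultimately show ?thesis
    unfolding comm_coeff_E by (auto simp: proper_op_def)
qed

lemma proper_virtual: "comm (proper_op i j) (virtual_op \<alpha> \<beta>) = 0"
  by (simp add: virtual_op_def comm_sum_right comm_mult_right proper_cre proper_ann delta_mult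
      sum.distrib sum.delta)

lemma virtual_virtual:
  "comm (virtual_op \<alpha> \<beta>) (virtual_op \<gamma> \<delta>) =
     (if \<beta> = \<gamma> then virtual_op \<alpha> \<delta> else 0) - (if \<alpha> = \<delta> then virtual_op \<gamma> \<beta> else 0)"
proof -
  have "comm (virtual_op \<alpha> \<beta>) (virtual_op \<gamma> \<delta>) =
      (\<Sum>k\<in>UNIV. comm (virtual_op \<alpha> \<beta>) (cre (\<gamma>, k) * ann (\<delta>, k)))"
    by (simp add: virtual_op_def[of \<gamma> \<delta>] comm_sum_right)
  also have "\<dots> = (if \<beta> = \<gamma> then virtual_op \<alpha> \<delta> else 0) - (if \<alpha> = \<delta> then virtual_op \<gamma> \<beta> else 0)"
    unfolding comm_mult_right virtual_cre virtual_ann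
    by (simp add: delta_mult sum.distrib sum_negf virtual_op_def)
  finally show ?thesis .
qed

lemma proper_lowering:
  "comm (proper_op i j) (lowering_op k \<alpha>) = (if j = k then lowering_op i \<alpha> else 0)"
  by (simp add: lowering_op_def comm_sum_right comm_mult_right proper_proper proper_ann delta_mult
      sum.distrib left_diff_distrib sum_subtractf sum.delta)

lemma virtual_lowering:
  "comm (virtual_op \<alpha> \<beta>) (lowering_op i \<gamma>) = (if \<alpha> = \<gamma> then - lowering_op i \<beta> else 0)"
  by (simp add: lowering_op_def comm_sum_right comm_mult_right virtual_ann
      comm_swap[of _ "proper_op _ _"] proper_virtual delta_mult sum_negf)

text \<open>The superbracket that determines \<open>lowering_op\<close>: of the two terms on the right the first comes
  from contracting \<open>ann\<close> with the new variable, the second from the derivation \<open>proper_op\<close>.\<close>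

lemma cre_lowering:
  "cre (\<beta>, j) * lowering_op i \<alpha> + lowering_op i \<alpha> * cre (\<beta>, j) =
     (if \<alpha> = \<beta> then proper_op i j else 0) + (if i = j then virtual_op \<beta> \<alpha> else 0)"
proof -
  have "cre (\<beta>, j) * (proper_op i k * ann (\<alpha>, k)) + proper_op i k * ann (\<alpha>, k) * cre (\<beta>, j)
      = (if \<alpha> = \<beta> \<and> k = j then proper_op i k else 0)
        + (if i = j then cre (\<beta>, k) * ann (\<alpha>, k) else 0)" for k
  proof -
    have "cre (\<beta>, j) * (proper_op i k * ann (\<alpha>, k)) + proper_op i k * ann (\<alpha>, k) * cre (\<beta>, j)
       = proper_op i k * (ann (\<alpha>, k) * cre (\<beta>, j) + cre (\<beta>, j) * ann (\<alpha>, k))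
         - comm (proper_op i k) (cre (\<beta>, j)) * ann (\<alpha>, k)"
      by (simp add: comm_def algebra_simps)
    then show ?thesis by (simp add: ann_cre proper_cre)
  qed
  then show ?thesis
    by (simp add: lowering_op_def virtual_op_def sum_distrib_left sum_distrib_right
        sum.distrib[symmetric] sum_prod_delta)
      (simp add: sum.distrib sum_prod_delta)
qed

text \<open>Moving everything to the form \<open>proper_op * proper_op * ann * ann\<close>, the symmetric part cancels
  because the annihilators anticommute, and the commutators of the \<open>proper_op\<close> cancel against the
  terms that arise from moving \<open>ann\<close> past \<open>proper_op\<close>.\<close>

lemma lowering_lowering: "lowering_op i \<alpha> * lowering_op j \<beta> + lowering_op j \<beta> * lowering_op i \<alpha> = 0"
proof -
  \<comment> \<open>The correction term \<open>ann (\<alpha>, j) * ann (\<beta>, k)\<close> is what the commutators of the \<open>proper_op\<close> cancel.\<close>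
  have ann_lowering: "ann (\<alpha>, k) * lowering_op j \<beta> =
     - (lowering_op j \<beta> * ann (\<alpha>, k) + ann (\<alpha>, j) * ann (\<beta>, k))" for k
  proof -
    have "ann (\<alpha>, k) * (proper_op j l * ann (\<beta>, l)) =
        - (proper_op j l * ann (\<beta>, l) * ann (\<alpha>, k)) - (if l = k then ann (\<alpha>, j) * ann (\<beta>, l) else 0)" for l
    proof -
      have "ann (\<alpha>, k) * (proper_op j l * ann (\<beta>, l)) =
          proper_op j l * (ann (\<alpha>, k) * ann (\<beta>, l)) - comm (proper_op j l) (ann (\<alpha>, k)) * ann (\<beta>, l)"
        by (simp add: comm_def algebra_simps)
      then show ?thesis
        unfolding proper_ann ann_ann[of "(\<alpha>, k)" "(\<beta>, l)"] by (auto simp: algebra_simps)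
    qed
    then show ?thesis
      by (simp add: lowering_op_def sum_distrib_left sum_distrib_right sum_subtractf sum_negf)
  qed
  have "lowering_op i \<alpha> * lowering_op j \<beta> = (\<Sum>k\<in>UNIV. proper_op i k * (ann (\<alpha>, k) * lowering_op j \<beta>))"
    by (simp add: lowering_op_def[of i \<alpha>] sum_distrib_right mult.assoc)
  also have "\<dots> = - (\<Sum>k\<in>UNIV. comm (proper_op i k) (lowering_op j \<beta>) * ann (\<alpha>, k))
      - lowering_op j \<beta> * lowering_op i \<alpha>
      + (\<Sum>k\<in>UNIV. proper_op i k * ann (\<beta>, k)) * ann (\<alpha>, j)"
    unfolding ann_lowering lowering_op_def[of i \<alpha>] sum_distrib_left sum_distrib_right
      sum_negf[symmetric] sum_subtractf[symmetric] sum.distrib[symmetric]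
    by (rule sum.cong) (simp_all add: comm_def algebra_simps ann_ann[of "(\<alpha>, j)"])
  also have "\<dots> = - (lowering_op j \<beta> * lowering_op i \<alpha>)"
    by (simp add: proper_lowering delta_mult sum.delta lowering_op_def[of i \<beta>])
  finally show ?thesis by simp
qed

fun kac :: "'m + 'n \<Rightarrow> 'm + 'n \<Rightarrow> (('m::finite \<times> 'n) set \<Rightarrow> 'v) endo" where
  "kac (Inr i) (Inr j) = proper_op i j"
| "kac (Inl \<alpha>) (Inl \<beta>) = virtual_op \<alpha> \<beta>"
| "kac (Inl \<alpha>) (Inr i) = cre (\<alpha>, i)"
| "kac (Inr i) (Inl \<alpha>) = lowering_op i \<alpha>"

text \<open>The Kac module is a module over \<open>gl(m|n)\<close>. Up to the symmetry of the superbracket there are ten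
  cases, which are the commutation rules above.\<close>

lemma kac_bracket:
  "kac a b * kac c d - flip (odd (gen_parity (a, b) * gen_parity (c, d))) (kac c d * kac a b) =
     (if b = c then kac a d else 0)
     - flip (odd (gen_parity (a, b) * gen_parity (c, d))) (if a = d then kac c b else 0)"
proof -
  note rels = proper_cre proper_proper proper_virtual proper_lowering virtual_cre virtual_virtual
    virtual_lowering
  note rels' = rels[unfolded comm_def]
  have swap: "A * B - B * A = - C" if "B * A - A * B = C" for A B C :: "(('m \<times> 'n) set \<Rightarrow> 'v) endo"
    using that by (simp add: algebra_simps)
  have creations: "cre (\<alpha>, i) * cre (\<beta>, j) + cre (\<beta>, j) * cre (\<alpha>, i) = 0" for \<alpha> \<beta> i j
    by (subst cre_cre) simp
  show ?thesis
    by (cases a; cases b; cases c; cases d)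
      (simp_all add: flip_def rels' rels'[THEN swap] cre_lowering creations lowering_lowering
        cre_lowering[unfolded add.commute[of "cre _ * lowering_op _ _"]])
qed

end

section \<open>Relations in the enveloping algebra\<close>

lemma free_alg_induct [case_names single add]:
  fixes x :: "'a fmon \<Rightarrow>\<^sub>0 complex"
  assumes single: "\<And>k c. P (Poly_Mapping.single k c)"
    and add: "\<And>x y. P x \<Longrightarrow> P y \<Longrightarrow> P (x + y)"
  shows "P x"
proof -
  have "x = (\<Sum>k\<in>Poly_Mapping.keys x. Poly_Mapping.single k (Poly_Mapping.lookup x k))"
    by (rule poly_mapping_eqI)
      (auto simp: lookup_sum lookup_single when_def sum.delta in_keys_iff)
  moreover have "P (\<Sum>k\<in>K. Poly_Mapping.single k (Poly_Mapping.lookup x k))" if "finite K" for K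
    using that
  proof induction
    case empty
    then show ?case using single[of 0 0] by simp
  qed (simp add: single add)
  ultimately show ?thesis by (metis finite_keys)
qed

lemma env_scalar_0 [simp]: "env_scalar 0 = 0" and env_scalar_1 [simp]: "env_scalar 1 = 1"
  and env_scalar_add: "env_scalar (c + d) = env_scalar c + env_scalar d"
  and env_scalar_uminus: "env_scalar (- c) = - env_scalar c"
  and env_scalar_mult: "env_scalar (c * d) = env_scalar c * env_scalar d"
  by (transfer; simp add: env_rel_def env_ideal_zero single_add single_uminus mult_single)+

lemma env_scalar_central: "x * env_scalar c = env_scalar c * x"
proof transfer
  fix x :: "('a, 'b) free_alg" and c
  have "x * Poly_Mapping.single 0 c = Poly_Mapping.single 0 c * x"
    by (induction x rule: free_alg_induct) (simp_all add: mult_single mult.commute algebra_simps)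
  then show "env_rel (x * Poly_Mapping.single 0 c) (Poly_Mapping.single 0 c * x)"
    by (simp add: env_rel_def env_ideal_zero)
qed

lemma env_gen_bracket:
  "env_gen a b * env_gen c d - flip (odd (gen_parity (a, b) * gen_parity (c, d))) (env_gen c d * env_gen a b) =
     (if b = c then env_gen a d else 0)
     - flip (odd (gen_parity (a, b) * gen_parity (c, d))) (if a = d then env_gen c b else 0)"
proof -
  let ?s = "gen_parity (a, b) * gen_parity (c, d)"
  have sign: "(-1) ^ ?s * z = flip (odd ?s) z" for z :: "'r::ring_1"
    by (simp add: flip_def minus_one_power_iff)
  have "1 * (free_gen (a, b) * free_gen (c, d) - (-1) ^ ?s * (free_gen (c, d) * free_gen (a, b))
      - free_bracket (a, b) (c, d)) * 1 \<in> env_ideal"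
    unfolding env_ideal_def by (intro ideal_gen.gen) blast
  then have "env_rel
      (free_gen (a, b) * free_gen (c, d) - flip (odd ?s) (free_gen (c, d) * free_gen (a, b)))
      ((if b = c then free_gen (a, d) else 0) - flip (odd ?s) (if a = d then free_gen (c, b) else 0))"
    unfolding env_rel_def free_bracket.simps sign mult_1_left mult_1_right .
  then have "abs_env
      (free_gen (a, b) * free_gen (c, d) - flip (odd ?s) (free_gen (c, d) * free_gen (a, b))) =
      abs_env ((if b = c then free_gen (a, d) else 0) - flip (odd ?s) (if a = d then free_gen (c, b) else 0))"
    unfolding env.abs_eq_iff .
  moreover have "abs_env (flip P z) = flip P (abs_env z)" for P and z :: "('a, 'b) free_alg"
    by (simp add: flip_def uminus_env.abs_eq)
  moreover have "abs_env (if P then z else 0) = (if P then abs_env z else 0)" for P and z :: "('a, 'b) free_alg"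
    by (simp add: zero_env_def)
  ultimately show ?thesis
    by (simp only: minus_env.abs_eq[symmetric] times_env.abs_eq[symmetric] env_gen.abs_eq[symmetric])
qed

text \<open>The commutator of \<open>e_{a,\<gamma>}\<close> with an element of \<open>gl(n)\<close> is again of the form \<open>e_{b,\<gamma>}\<close>; this is
  why the left ideal of the next definition absorbs \<open>env_gl\<close> from the right.\<close>

lemma virtual_env_gen_past_proper:
  "env_gen a (Inl \<gamma>) * env_gen (Inr i) (Inr j) =
     env_gen (Inr i) (Inr j) * env_gen a (Inl \<gamma>) - (if a = Inr j then env_gen (Inr i) (Inl \<gamma>) else 0)"
  using env_gen_bracket[of a "Inl \<gamma>" "Inr i" "Inr j"]
  by (auto simp: flip_def algebra_simps split: if_splits)

section \<open>The left ideal generated by the annihilators of virtual symbols\<close>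

text \<open>Its generators are irregular words of one letter, so it lies in \<open>Irr\<close>; unlike for \<open>Irr\<close> itself,
  membership is easy to follow through commutator computations.\<close>

definition virtual_ideal :: "('m, 'n) env set"
  where "virtual_ideal = left_ideal_gen {env_gen a (Inl \<gamma>) | a \<gamma>. True}"

lemma left_ideal_gen_mult_left: "x \<in> left_ideal_gen S \<Longrightarrow> c * x \<in> left_ideal_gen S"
proof (induction rule: left_ideal_gen.induct)
  case (gen x a)
  then show ?case using left_ideal_gen.gen[of x S "c * a"] by (simp add: mult.assoc)
qed (auto simp: distrib_left intro: left_ideal_gen.intros)

lemma left_ideal_gen_uminus: "x \<in> left_ideal_gen S \<Longrightarrow> - x \<in> left_ideal_gen S"
  using left_ideal_gen_mult_left[of x S "-1"] by simp

lemma left_ideal_gen_diff: "x \<in> left_ideal_gen S \<Longrightarrow> y \<in> left_ideal_gen S \<Longrightarrow> x - y \<in> left_ideal_gen S"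
  using left_ideal_gen.add[of x S "- y"] left_ideal_gen_uminus by fastforce

lemma left_ideal_gen_base: "x \<in> S \<Longrightarrow> x \<in> left_ideal_gen S"
  using left_ideal_gen.gen[of x S 1] by simp

lemma virtual_gen_mult_gl:
  assumes "u \<in> env_gl"
  shows "env_gen a (Inl \<gamma>) * u \<in> virtual_ideal"
  using assms
proof (induction arbitrary: a \<gamma>)
  case (scalar c)
  then show ?case
    by (auto simp: virtual_ideal_def env_scalar_central intro: left_ideal_gen.gen)
next
  case (gen i j)
  have "env_gen (Inr i) (Inr j) * env_gen a (Inl \<gamma>) \<in> virtual_ideal"
    unfolding virtual_ideal_def by (rule left_ideal_gen.gen) auto
  moreover have "(if a = Inr j then env_gen (Inr i) (Inl \<gamma>) else 0) \<in> virtual_ideal"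
    unfolding virtual_ideal_def by (auto intro: left_ideal_gen_base left_ideal_gen.zero)
  ultimately show ?case
    unfolding virtual_env_gen_past_proper virtual_ideal_def by (rule left_ideal_gen_diff)
next
  case (add x y)
  then show ?case by (simp add: virtual_ideal_def distrib_left left_ideal_gen.add)
next
  case (mult x y)
  have "z * y \<in> virtual_ideal" if "z \<in> virtual_ideal" for z
    using that unfolding virtual_ideal_def
  proof (induction rule: left_ideal_gen.induct)
    case (gen w b)
    then show ?case
      using mult.IH(2) left_ideal_gen_mult_left by (fastforce simp: virtual_ideal_def mult.assoc)
  qed (auto simp: distrib_right intro: left_ideal_gen.intros)
  from this[OF mult.IH(1)[of a \<gamma>]] show ?case by (simp add: mult.assoc)
qed

text \<open>Modulo the virtual ideal, level \<open>r\<close> consists of the sums of products of \<open>r\<close> generators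
  \<open>e_{\<alpha>,i}\<close> with an element of \<open>env_gl\<close>. In the Kac module this is the degree in the odd variables,
  so every generator of \<open>gl(m|n)\<close> shifts the level by \<open>1\<close>, \<open>0\<close> or \<open>-1\<close>.\<close>

inductive creation_level :: "nat \<Rightarrow> ('m, 'n) env \<Rightarrow> bool" where
  gl: "u \<in> env_gl \<Longrightarrow> creation_level 0 u"
| create: "creation_level r x \<Longrightarrow> creation_level (Suc r) (env_gen (Inl \<alpha>) (Inr i) * x)"
| add: "creation_level r x \<Longrightarrow> creation_level r y \<Longrightarrow> creation_level r (x + y)"
| ideal: "x \<in> virtual_ideal \<Longrightarrow> creation_level r x"

lemma creation_level_zero: "creation_level r 0"
  by (rule creation_level.ideal) (simp add: virtual_ideal_def left_ideal_gen.zero)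

lemma creation_level_uminus: "creation_level r x \<Longrightarrow> creation_level r (- x)"
proof (induction rule: creation_level.induct)
  case (gl u)
  then have "env_scalar (-1) * u \<in> env_gl" by (intro env_gl.intros)
  then show ?case by (simp add: env_scalar_uminus creation_level.gl)
next
  case (create r x \<alpha> i)
  then show ?case using creation_level.create[of r "- x" \<alpha> i] by simp
next
  case (add r x y)
  then show ?case using creation_level.add[of r "- x" "- y"] by simp
next
  case (ideal x r)
  then show ?case by (simp add: creation_level.ideal virtual_ideal_def left_ideal_gen_uminus)
qed

lemma creation_level_diff: "creation_level r x \<Longrightarrow> creation_level r y \<Longrightarrow> creation_level r (x - y)"
  using creation_level.add[of r x "- y"] creation_level_uminus[of r y] by simp

lemma creation_level_if:
  "(P \<Longrightarrow> creation_level r x) \<Longrightarrow> creation_level r (if P then x else 0)"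
  by (simp add: creation_level_zero)

lemma virtual_ideal_mult_left: "x \<in> virtual_ideal \<Longrightarrow> c * x \<in> virtual_ideal"
  by (simp add: virtual_ideal_def left_ideal_gen_mult_left)

lemma creation_level_proper:
  "creation_level r x \<Longrightarrow> creation_level r (env_gen (Inr i) (Inr j) * x)"
proof (induction rule: creation_level.induct)
  case (gl u)
  then show ?case by (intro creation_level.gl env_gl.intros)
next
  case (create r x \<alpha> k)
  have "env_gen (Inr i) (Inr j) * (env_gen (Inl \<alpha>) (Inr k) * x) =
      env_gen (Inl \<alpha>) (Inr k) * (env_gen (Inr i) (Inr j) * x)
      - (if i = k then env_gen (Inl \<alpha>) (Inr j) * x else 0)"
    using arg_cong[OF env_gen_bracket[of "Inr i" "Inr j" "Inl \<alpha>" "Inr k"], of "\<lambda>z. z * x"]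
    by (auto simp: flip_def algebra_simps)
  then show ?case
    by (simp only:) (intro creation_level_diff creation_level_if creation_level.create create.IH create.hyps)
next
  case (add r x y)
  then show ?case by (simp add: distrib_left creation_level.add)
next
  case (ideal x r)
  then show ?case by (intro creation_level.ideal virtual_ideal_mult_left)
qed

lemma creation_level_virtual:
  "creation_level r x \<Longrightarrow> creation_level r (env_gen (Inl \<alpha>) (Inl \<beta>) * x)"
proof (induction rule: creation_level.induct)
  case (gl u)
  then show ?case by (intro creation_level.ideal virtual_gen_mult_gl)
next
  case (create r x \<gamma> k)
  have "env_gen (Inl \<alpha>) (Inl \<beta>) * (env_gen (Inl \<gamma>) (Inr k) * x) =
      env_gen (Inl \<gamma>) (Inr k) * (env_gen (Inl \<alpha>) (Inl \<beta>) * x)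
      + (if \<beta> = \<gamma> then env_gen (Inl \<alpha>) (Inr k) * x else 0)"
    using arg_cong[OF env_gen_bracket[of "Inl \<alpha>" "Inl \<beta>" "Inl \<gamma>" "Inr k"], of "\<lambda>z. z * x"]
    by (auto simp: flip_def algebra_simps)
  then show ?case
    by (simp only:) (intro creation_level.add creation_level_if creation_level.create create.IH create.hyps)
next
  case (add r x y)
  then show ?case by (simp add: distrib_left creation_level.add)
next
  case (ideal x r)
  then show ?case by (intro creation_level.ideal virtual_ideal_mult_left)
qed

text \<open>At level \<open>0\<close> nothing is left to annihilate and the product falls into the virtual ideal. This
  case has to be part of the induction, because moving \<open>e_{i,\<alpha>}\<close> past the last creation reaches it.\<close>

lemma creation_level_annihilate_aux:
  "creation_level r x \<Longrightarrow>
     (case r of 0 \<Rightarrow> env_gen (Inr i) (Inl \<alpha>) * x \<in> virtual_ideal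
      | Suc q \<Rightarrow> creation_level q (env_gen (Inr i) (Inl \<alpha>) * x))"
proof (induction rule: creation_level.induct)
  case (gl u)
  then show ?case by (simp add: virtual_gen_mult_gl)
next
  case (create r x \<gamma> k)
  have eq: "env_gen (Inr i) (Inl \<alpha>) * (env_gen (Inl \<gamma>) (Inr k) * x) =
      (if \<alpha> = \<gamma> then env_gen (Inr i) (Inr k) * x else 0)
      + (if i = k then env_gen (Inl \<gamma>) (Inl \<alpha>) * x else 0)
      - env_gen (Inl \<gamma>) (Inr k) * (env_gen (Inr i) (Inl \<alpha>) * x)"
    using arg_cong[OF env_gen_bracket[of "Inr i" "Inl \<alpha>" "Inl \<gamma>" "Inr k"], of "\<lambda>z. z * x"]
    by (auto simp: flip_def algebra_simps)
  have "creation_level r (env_gen (Inl \<gamma>) (Inr k) * (env_gen (Inr i) (Inl \<alpha>) * x))"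
    using create.IH
    by (cases r) (auto intro: creation_level.ideal virtual_ideal_mult_left creation_level.create)
  then have "creation_level r (env_gen (Inr i) (Inl \<alpha>) * (env_gen (Inl \<gamma>) (Inr k) * x))"
    unfolding eq
    by (intro creation_level_diff creation_level.add[of r "if _ then _ else _"] creation_level_if
        creation_level_proper creation_level_virtual create.hyps)
  then show ?case by simp
next
  case (add r x y)
  from add.IH show ?case
    by (cases r) (auto simp: distrib_left virtual_ideal_def intro: left_ideal_gen.add creation_level.add)
next
  case (ideal x r)
  then show ?case by (cases r) (auto intro: creation_level.ideal virtual_ideal_mult_left)
qed

lemma creation_level_annihilate:
  "creation_level (Suc r) x \<Longrightarrow> creation_level r (env_gen (Inr i) (Inl \<alpha>) * x)"
  using creation_level_annihilate_aux by fastforce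

lemma creation_level_0_cases:
  assumes "creation_level 0 x"
  shows "\<exists>u\<in>env_gl. x - u \<in> virtual_ideal"
proof -
  have "r = 0 \<Longrightarrow> \<exists>u\<in>env_gl. x - u \<in> virtual_ideal" if "creation_level r x" for r and x :: "('a, 'b) env"
    using that
  proof (induction rule: creation_level.induct)
    case (gl u)
    then show ?case by (intro bexI[of _ u]) (auto simp: virtual_ideal_def left_ideal_gen.zero)
  next
    case (add r x y)
    then obtain u w where uw: "u \<in> env_gl" "w \<in> env_gl" "x - u \<in> virtual_ideal" "y - w \<in> virtual_ideal"
      by auto
    then have "(x - u) + (y - w) \<in> virtual_ideal"
      unfolding virtual_ideal_def by (intro left_ideal_gen.add)
    with uw show ?case
      by (intro bexI[of _ "u + w"]) (auto simp: algebra_simps intro: env_gl.add)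
  next
    case (ideal x r)
    moreover have "0 \<in> env_gl" using env_gl.scalar[of 0] by simp
    ultimately show ?case by (intro bexI[of _ 0]) auto
  qed simp
  with assms show ?thesis by blast
qed

lemma env_word_Nil [simp]: "env_word [] = 1"
  and env_word_Cons [simp]: "env_word (x # w) = env_gen (fst x) (snd x) * env_word w"
  by (simp_all add: env_word_def case_prod_beta)

text \<open>A bitableau lies in \<open>env_gl + Irr\<close>: its right half has as level the number of its letters, and
  every letter of the left half lowers the level by one, down to \<open>0\<close>.\<close>

lemma balanced_word_decomposition:
  assumes "length ss = length ts"
  shows "\<exists>u\<in>env_gl. env_word (map (\<lambda>(s, a). (Inr s, Inl a)) ss)
      * env_word (map (\<lambda>(t, a). (Inl a, Inr t)) ts) - u \<in> virtual_ideal"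
proof -
  have right: "creation_level (length ts) (env_word (map (\<lambda>(t, a). (Inl a, Inr t)) ts))"
    for ts :: "('n \<times> 'm) list"
  proof (induction ts)
    case Nil
    then show ?case using env_gl.scalar[of 1] by (auto intro: creation_level.gl)
  qed (auto intro: creation_level.create)
  have left: "creation_level (k + length ss) x \<Longrightarrow>
      creation_level k (env_word (map (\<lambda>(s, a). (Inr s, Inl a)) ss) * x)"
    for ss :: "('n \<times> 'm) list" and x k
    by (induction ss arbitrary: k) (auto simp: mult.assoc intro!: creation_level_annihilate)
  show ?thesis
    using creation_level_0_cases[OF left[of 0 ss, OF _]] right[of ts] assms by simp
qed

lemma virtual_ideal_Irr: "virtual_ideal \<subseteq> Irr"
proof
  fix x :: "('m, 'n) env"
  assume "x \<in> virtual_ideal"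
  then show "x \<in> Irr"
    unfolding virtual_ideal_def
  proof (induction rule: left_ideal_gen.induct)
    case (gen x a)
    then obtain b :: "'m + 'n" and \<gamma> where x: "x = env_word [(b, Inl \<gamma>)]"
      by auto

    have "{j \<in> {1..1}. snd ([(b, Inl \<gamma> :: 'm + 'n)] ! (length [(b, Inl \<gamma> :: 'm + 'n)] - j)) = Inl \<gamma>} = {1}"
      by auto
    then have "irregular [(b, Inl \<gamma>)]"
      unfolding irregular_def by (intro bexI[of _ 1] exI[of _ \<gamma>]) simp_all
    then show ?case
      unfolding Irr_def x by (intro left_ideal_gen.gen imageI CollectI)
  qed (auto simp: Irr_def intro: left_ideal_gen.intros)
qed

section \<open>The action of the enveloping algebra on the Kac module\<close>

text \<open>Translates the right-to-left counting in \<open>irregular\<close> into counting in a suffix of the word.\<close>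

lemma card_from_right:
  assumes "i \<le> length w"
  shows "card {j\<in>{1..i}. P (w ! (length w - j))} = length (filter P (drop (length w - i) w))"
proof -
  have "card {j\<in>{1..i}. P (w ! (length w - j))} = card {k. k < i \<and> P (drop (length w - i) w ! k)}"
    by (rule bij_betw_same_card[of "\<lambda>j. i - j"], rule bij_betw_byWitness[of _ "\<lambda>k. i - k"])
      (use assms in auto)
  then show ?thesis using assms by (simp add: length_filter_conv_card)
qed

context gl_rep
begin

lemma scalar_kac: "scalar c * kac a b = kac a b * scalar c"
proof -
  have proper: "scalar c * proper_op i j = proper_op i j * scalar c" for i j
    unfolding proper_op_def right_diff_distrib left_diff_distrib sum_distrib_left sum_distrib_right scalar_coeff_E
    by (simp add: scalar_cre scalar_ann mult.assoc[symmetric]) (simp add: scalar_ann mult.assoc)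
  show ?thesis
  proof (cases a; cases b)
    fix \<alpha> \<beta> assume "a = Inl \<alpha>" "b = Inl \<beta>"
    then show ?thesis
      by (simp add: virtual_op_def sum_distrib_left sum_distrib_right scalar_cre mult.assoc[symmetric])
        (simp add: scalar_ann mult.assoc)
  next
    fix i \<beta> assume "a = Inr i" "b = Inl \<beta>"
    then show ?thesis
      by (simp add: lowering_op_def sum_distrib_left sum_distrib_right proper mult.assoc[symmetric])
        (simp add: scalar_ann mult.assoc)
  qed (auto simp: proper scalar_cre)
qed

definition word_op :: "('m::finite, 'n) gen list \<Rightarrow> (('m \<times> 'n) set \<Rightarrow> 'v) endo"
  where "word_op w = prod_list (map (\<lambda>(a, b). kac a b) w)"

lemma word_op_simps [simp]: "word_op [] = 1" "word_op (x # w) = kac (fst x) (snd x) * word_op w"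
  "word_op (w @ w') = word_op w * word_op w'"
  by (simp_all add: word_op_def case_prod_beta)

lemma scalar_word_op: "scalar c * word_op w = word_op w * scalar c"
  by (induction w) (simp_all add: scalar_kac mult.assoc[symmetric], simp add: mult.assoc)

text \<open>The extension of \<open>kac\<close> to the free algebra. By \<open>kac_bracket\<close> it vanishes on the
  defining ideal and so descends to the enveloping algebra.\<close>

definition free_act :: "('m::finite, 'n) free_alg \<Rightarrow> (('m \<times> 'n) set \<Rightarrow> 'v) endo"
  where "free_act f = (\<Sum>k\<in>Poly_Mapping.keys f. scalar (Poly_Mapping.lookup f k) * word_op (letters k))"

lemma free_act_superset:
  assumes "finite K" "Poly_Mapping.keys f \<subseteq> K"
  shows "free_act f = (\<Sum>k\<in>K. scalar (Poly_Mapping.lookup f k) * word_op (letters k))"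
  unfolding free_act_def using assms
  by (intro sum.mono_neutral_left) (auto simp: in_keys_iff)

lemma free_act_add: "free_act (f + g) = free_act f + free_act g"
proof -
  let ?K = "Poly_Mapping.keys f \<union> Poly_Mapping.keys g"
  have "free_act h = (\<Sum>k\<in>?K. scalar (Poly_Mapping.lookup h k) * word_op (letters k))"
    if "Poly_Mapping.keys h \<subseteq> ?K" for h
    using that by (intro free_act_superset) auto
  then show ?thesis
    using Poly_Mapping.keys_add[of f g]
    by (simp add: lookup_add scalar_add distrib_right sum.distrib)
qed

lemma free_act_single: "free_act (Poly_Mapping.single k c) = scalar c * word_op (letters k)"
  using free_act_superset[of "{k}" "Poly_Mapping.single k c"] by simp

lemma free_act_mult: "free_act (f * g) = free_act f * free_act g"
proof (induction f rule: free_alg_induct)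
  case (single k c)
  show ?case
  proof (induction g rule: free_alg_induct)
    case (single l d)
    have "scalar c * scalar d * (word_op (letters k) * word_op (letters l)) =
        scalar c * (scalar d * word_op (letters k)) * word_op (letters l)"
      by (simp add: mult.assoc)
    also have "\<dots> = scalar c * word_op (letters k) * (scalar d * word_op (letters l))"
      by (simp only: scalar_word_op[of d "letters k"] mult.assoc)
    finally show ?case
      by (simp add: mult_single free_act_single scalar_mult plus_fmon_def)
  qed (simp add: distrib_left free_act_add)
qed (simp add: distrib_right free_act_add)

lemma free_act_0 [simp]: "free_act 0 = 0"
  by (simp add: free_act_def)

lemma free_act_uminus: "free_act (- f) = - free_act f"
  using free_act_add[of f "- f"] by (simp add: eq_neg_iff_add_eq_0 add.commute)

lemma free_act_diff: "free_act (f - g) = free_act f - free_act g"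
  using free_act_add[of f "- g"] by (simp add: free_act_uminus)

lemma free_act_gen: "free_act (free_gen (a, b)) = kac a b"
  by (simp add: free_gen_def free_act_single)

lemma free_act_ideal:
  fixes x :: "('m::finite, 'n) free_alg"
  shows "x \<in> env_ideal \<Longrightarrow> free_act x = 0"
  unfolding env_ideal_def
proof (induction rule: ideal_gen.induct)
  case (gen x y z)
  then obtain a b c d :: "'m + 'n" where x: "x = free_gen (a, b) * free_gen (c, d)
      - (-1) ^ (gen_parity (a, b) * gen_parity (c, d)) * (free_gen (c, d) * free_gen (a, b))
      - free_bracket (a, b) (c, d)"
    by auto
  let ?s = "gen_parity (a, b) * gen_parity (c, d)"
  have sign: "(-1) ^ ?s * w = flip (odd ?s) w" for w :: "('m, 'n) free_alg"
    by (simp add: flip_def minus_one_power_iff)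
  have flip: "free_act (flip P w) = flip P (free_act w)" for P and w :: "('m, 'n) free_alg"
    by (simp add: flip_def free_act_uminus)
  have cond: "free_act (if P then w else 0) = (if P then free_act w else 0)"
    for P and w :: "('m, 'n) free_alg"
    by simp
  have "free_act x = 0"
    unfolding x free_bracket.simps sign free_act_diff flip cond free_act_mult free_act_gen
      kac_bracket
    by simp
  then show ?case by (simp add: free_act_mult)
qed (simp_all add: free_act_add)

definition act :: "('m::finite, 'n) env \<Rightarrow> (('m \<times> 'n) set \<Rightarrow> 'v) endo"
  where "act x = free_act (rep_env x)"

lemma act_abs: "act (abs_env f) = free_act f"
proof -
  have "env_rel (rep_env (abs_env f)) f"
    by (rule Quotient3_rep_abs[OF Quotient3_env]) (simp add: env_rel_def env_ideal_zero)
  then have "free_act (rep_env (abs_env f) - f) = 0"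
    unfolding env_rel_def by (rule free_act_ideal)
  then show ?thesis by (simp add: act_def free_act_diff)
qed

lemma act_add [simp]: "act (x + y) = act x + act y"
  by (induction x rule: env.abs_induct, induction y rule: env.abs_induct)
    (simp add: plus_env.abs_eq act_abs free_act_add)

lemma act_mult [simp]: "act (x * y) = act x * act y"
  by (induction x rule: env.abs_induct, induction y rule: env.abs_induct)
    (simp add: times_env.abs_eq act_abs free_act_mult)

lemma act_gen [simp]: "act (env_gen a b) = kac a b"
  by (simp add: env_gen.abs_eq act_abs free_act_gen)

lemma act_scalar [simp]: "act (env_scalar c) = scalar c"
  by (simp add: env_scalar.abs_eq act_abs free_act_single zero_fmon_def)

lemma act_0 [simp]: "act 0 = 0"
  using act_scalar[of 0] by simp

lemma act_word [simp]: "act (env_word w) = word_op w"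
  by (induction w) (simp_all add: env_word_Cons, metis act_scalar env_scalar_1 scalar_1)

lemma proper_op_vac: "app (proper_op i j) (vac x) = vac (E i j x)"
proof -
  have "app (coeff_E i j) (vac x) = vac (E i j x)"
    by (simp add: coeff_E_def coeffwise_vac additive_E)
  then show ?thesis
    by (simp add: proper_op_def app_sum ann_vac app_arith_right)
qed

lemma scalar_vac: "app (scalar c) (vac x) = vac (scal c x)"
  by (simp add: scalar_def coeffwise_vac additive_scal)

lemma vac_add: "vac (x + y) = vac x + vac y"
  by (auto simp: vac_def fun_eq_iff)

text \<open>The vacuum copy of \<open>V\<close> is a \<open>gl(n)\<close>-submodule of the Kac module. Through it, modules over
  \<open>gl(n)\<close> become modules over the subalgebra \<open>env_gl\<close>, without a basis theorem for enveloping
  algebras.\<close>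

lemma act_gl_vac:
  assumes "x \<in> env_gl"
  shows "\<exists>w. app (act x) (vac v) = vac w"
  using assms
proof (induction arbitrary: v)
  case (scalar c)
  then show ?case by (auto simp: scalar_vac)
next
  case (gen i j)
  then show ?case by (auto simp: proper_op_vac)
next
  case (add x y)
  then show ?case by (metis act_add app_arith(3) vac_add)
next
  case (mult x y)
  then show ?case by (metis act_mult app_arith(6))
qed

section \<open>Irregular words annihilate the representation\<close>

text \<open>The number of odd variables with virtual index \<open>\<gamma>\<close>. The degree is an integer and may be
  negative, in which case only the zero vector has it.\<close>

definition virtual_content :: "'m \<Rightarrow> int \<Rightarrow> (('m::finite \<times> 'n) set \<Rightarrow> 'v) \<Rightarrow> bool"
  where "virtual_content \<gamma> k f \<longleftrightarrow> (\<forall>S. f S \<noteq> 0 \<longrightarrow> int (card {i. (\<gamma>, i) \<in> S}) = k)"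

lemma content_vac: "virtual_content \<gamma> 0 (vac x)"
  by (simp add: virtual_content_def vac_def)

lemma content_diff: "virtual_content \<gamma> k f \<Longrightarrow> virtual_content \<gamma> k g \<Longrightarrow> virtual_content \<gamma> k (f - g)"
  by (auto simp: virtual_content_def) (metis diff_self)

lemma content_sum: "(\<And>i. i \<in> I \<Longrightarrow> virtual_content \<gamma> k (F i)) \<Longrightarrow> virtual_content \<gamma> k (\<Sum>i\<in>I. F i)"
proof -
  have "(\<Sum>i\<in>I. F i) S = (\<Sum>i\<in>I. F i S)" for S
    by (induction I rule: infinite_finite_induct) auto
  then show "(\<And>i. i \<in> I \<Longrightarrow> virtual_content \<gamma> k (F i)) \<Longrightarrow> virtual_content \<gamma> k (\<Sum>i\<in>I. F i)"
    unfolding virtual_content_def by (metis sum.neutral)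
qed

lemma content_negative: "virtual_content \<gamma> k f \<Longrightarrow> k < 0 \<Longrightarrow> f = 0"
  by (fastforce simp: virtual_content_def fun_eq_iff)

lemma content_coeff_E: "virtual_content \<gamma> k f \<Longrightarrow> virtual_content \<gamma> k (app (coeff_E i j) f)"
  unfolding virtual_content_def app_coeff_E by (metis Modules.additive.zero[OF additive_E])

lemma content_cre: 
  assumes "virtual_content \<gamma> k f"
  shows "virtual_content \<gamma> (if \<delta> = \<gamma> then k + 1 else k) (app (cre (\<delta>, i)) f)"
  unfolding virtual_content_def
proof (intro allI impI)
  fix S assume nz: "app (cre (\<delta>, i)) f S \<noteq> 0"
  then have S: "(\<delta>, i) \<in> S" "f (S - {(\<delta>, i)}) \<noteq> 0"
    by (auto simp: cre.rep_eq flip_def split: if_splits)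
  define A where "A = {l. (\<gamma>, l) \<in> S - {(\<delta>, i)}}"
  have A: "int (card A) = k"
    using assms[unfolded virtual_content_def, rule_format, OF S(2)] unfolding A_def .
  show "int (card {l. (\<gamma>, l) \<in> S}) = (if \<delta> = \<gamma> then k + 1 else k)"
  proof (cases "\<delta> = \<gamma>")
    case True
    have "{l. (\<gamma>, l) \<in> S} = insert i A" "i \<notin> A"
      unfolding A_def using S(1) True by blast+
    with A True show ?thesis by simp
  next
    case False
    then have "{l. (\<gamma>, l) \<in> S} = A" unfolding A_def by blast
    with A False show ?thesis by simp
  qed
qed

lemma content_ann: 
  assumes "virtual_content \<gamma> k f"
  shows "virtual_content \<gamma> (if \<delta> = \<gamma> then k - 1 else k) (app (ann (\<delta>, i)) f)"
  unfolding virtual_content_def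
proof (intro allI impI)
  fix S assume nz: "app (ann (\<delta>, i)) f S \<noteq> 0"
  then have S: "(\<delta>, i) \<notin> S" "f (insert (\<delta>, i) S) \<noteq> 0"
    by (auto simp: ann.rep_eq flip_def split: if_splits)
  define A where "A = {l. (\<gamma>, l) \<in> insert (\<delta>, i) S}"
  have A: "int (card A) = k"
    using assms[unfolded virtual_content_def, rule_format, OF S(2)] unfolding A_def .
  show "int (card {l. (\<gamma>, l) \<in> S}) = (if \<delta> = \<gamma> then k - 1 else k)"
  proof (cases "\<delta> = \<gamma>")
    case True
    have "A = insert i {l. (\<gamma>, l) \<in> S}" "i \<notin> {l. (\<gamma>, l) \<in> S}"
      unfolding A_def using S(1) True by blast+
    with A True show ?thesis by simp
  next
    case False
    then have "A = {l. (\<gamma>, l) \<in> S}" unfolding A_def by blast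
    with A False show ?thesis by simp
  qed
qed

lemma content_proper: "virtual_content \<gamma> k f \<Longrightarrow> virtual_content \<gamma> k (app (proper_op i j) f)"
proof -
  assume f: "virtual_content \<gamma> k f"
  have "virtual_content \<gamma> k (app (cre (\<delta>, j)) (app (ann (\<delta>, i)) f))" for \<delta>
    using content_cre[OF content_ann[OF f, of \<delta> i], of \<delta> j] by (auto split: if_splits)
  with f show ?thesis
    by (simp add: proper_op_def app_sum content_diff content_sum content_coeff_E)
qed

lemma content_kac:
  assumes f: "virtual_content \<gamma> k f"
  shows "virtual_content \<gamma> (k + of_bool (a = Inl \<gamma>) - of_bool (b = Inl \<gamma>)) (app (kac a b) f)"
proof (cases a; cases b)
  fix \<alpha> \<beta> assume ab: "a = Inl \<alpha>" "b = Inl \<beta>"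
  have "virtual_content \<gamma> (k + of_bool (\<alpha> = \<gamma>) - of_bool (\<beta> = \<gamma>)) (app (cre (\<alpha>, i)) (app (ann (\<beta>, i)) f))" for i
    using content_cre[OF content_ann[OF f, of \<beta> i], of \<alpha> i] by (auto split: if_splits)
  with ab show ?thesis by (simp add: virtual_op_def app_sum content_sum)
next
  fix i \<alpha> assume ab: "a = Inl \<alpha>" "b = Inr i"
  then show ?thesis using content_cre[OF f, of \<alpha> i] by (auto split: if_splits)
next
  fix i \<alpha> assume ab: "a = Inr i" "b = Inl \<alpha>"
  have "virtual_content \<gamma> (k - of_bool (\<alpha> = \<gamma>)) (app (proper_op i j) (app (ann (\<alpha>, j)) f))" for j
    using content_proper[OF content_ann[OF f, of \<alpha> j], of i j] by (auto split: if_splits)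
  with ab show ?thesis by (simp add: lowering_op_def app_sum content_sum)
next
  fix i j assume ab: "a = Inr i" "b = Inr j"
  with f show ?thesis by (simp add: content_proper)
qed

lemma kac_content_zero:
  assumes "virtual_content \<gamma> 0 f"
  shows "app (kac a (Inl \<gamma>)) f = 0"
proof -
  have "app (ann (\<gamma>, i)) f = 0" for i
    using content_ann[OF assms, of \<gamma> i] by (intro content_negative[of \<gamma> "-1"]) auto
  then show ?thesis
    by (cases a) (simp_all add: virtual_op_def lowering_op_def app_sum app_arith_right)
qed

lemma content_word:
  "virtual_content \<gamma> (int (length (filter (\<lambda>x. fst x = Inl \<gamma>) w)) - int (length (filter (\<lambda>x. snd x = Inl \<gamma>) w)))
     (app (word_op w) (vac x))"
proof (induction w)
  case Nil
  then show ?case by (simp add: content_vac)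
next
  case (Cons y w)
  from content_kac[OF this, of "fst y" "snd y"] show ?case
    by (auto simp: algebra_simps split: if_splits)
qed

text \<open>Read from the right, an irregular word tries at some letter to annihilate a virtual symbol more
  often than it has been created. There the \<open>\<gamma>\<close>-content is already negative, or it is zero and the
  letter annihilates \<open>\<gamma>\<close>; the vector vanishes in both cases.\<close>

lemma irregular_kills:
  assumes "irregular w"
  shows "app (word_op w) (vac x) = 0"
proof -
  from assms obtain i \<gamma> where i: "1 \<le> i" "i \<le> length w"
    and less: "card {j\<in>{1..<i}. fst (w ! (length w - j)) = Inl \<gamma>}
       < card {j\<in>{1..i}. snd (w ! (length w - j)) = Inl \<gamma>}"
    unfolding irregular_def by auto
  let ?w = "drop (length w - (i - 1)) w"
  let ?a = "fst (w ! (length w - i))" and ?b = "snd (w ! (length w - i))"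
  \<comment> \<open>The letter at which the count fails, followed by the letters that have already acted.\<close>
  have split: "drop (length w - i) w = w ! (length w - i) # ?w"
    using i by (subst Cons_nth_drop_Suc[symmetric]) (auto simp: Suc_diff_le)
  have "{1..<i} = {1..i - 1}" using i by auto
  moreover have "card {j\<in>{1..i - 1}. fst (w ! (length w - j)) = Inl \<gamma>}
      = length (filter (\<lambda>x. fst x = Inl \<gamma>) ?w)"
    using i by (intro card_from_right) auto
  moreover have "card {j\<in>{1..i}. snd (w ! (length w - j)) = Inl \<gamma>}
      = length (filter (\<lambda>x. snd x = Inl \<gamma>) (drop (length w - i) w))"
    using i by (intro card_from_right) auto
  ultimately have "length (filter (\<lambda>x. fst x = Inl \<gamma>) ?w)
      < length (filter (\<lambda>x. snd x = Inl \<gamma>) (drop (length w - i) w))"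
    using less by (simp only:)
  then have less: "length (filter (\<lambda>x. fst x = Inl \<gamma>) ?w)
      < of_bool (?b = Inl \<gamma>) + length (filter (\<lambda>x. snd x = Inl \<gamma>) ?w)"
    unfolding split by (simp split: if_splits)
  let ?k = "int (length (filter (\<lambda>x. fst x = Inl \<gamma>) ?w)) - int (length (filter (\<lambda>x. snd x = Inl \<gamma>) ?w))"
  have content: "virtual_content \<gamma> ?k (app (word_op ?w) (vac x))"
    by (rule content_word)
  have "app (kac ?a ?b) (app (word_op ?w) (vac x)) = 0"
  proof (cases "?k < 0")
    case True
    from content_negative[OF content this] show ?thesis by (simp only: app_arith_right)
  next
    case False
    with less have "?b = Inl \<gamma>" "?k = 0" by (simp_all add: of_bool_def split: if_splits)
    with content show ?thesis by (simp add: kac_content_zero)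
  qed
  then have "app (word_op (drop (length w - i) w)) (vac x) = 0"
    unfolding split by simp
  moreover have "word_op w = word_op (take (length w - i) w) * word_op (drop (length w - i) w)"
    by (metis append_take_drop_id word_op_simps(3))
  ultimately show ?thesis by (simp add: app_arith_right)
qed

lemma Irr_kills: "y \<in> Irr \<Longrightarrow> app (act y) (vac x) = 0"
  unfolding Irr_def
  by (induction rule: left_ideal_gen.induct) (auto simp: irregular_kills app_arith_right)

end

section \<open>Devirtualization\<close>

lemma env_left_regular:
  "gl_rep (\<lambda>c x :: ('m, 'n::finite) env. env_scalar c * x) (\<lambda>i j x. env_gen (Inr i) (Inr j) * x)"
proof -
  interpret V: vector_space "\<lambda>c x :: ('m, 'n) env. env_scalar c * x"
    by standard (simp_all add: distrib_left distrib_right env_scalar_add env_scalar_mult mult.assoc)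
  show ?thesis
  proof (standard)
    fix i j c and x y :: "('m, 'n) env"
    show "env_gen (Inr i) (Inr j) * (env_scalar c * x) = env_scalar c * (env_gen (Inr i) (Inr j) * x)"
      by (metis env_scalar_central mult.assoc)
  next
    fix i j k l and x :: "('m, 'n) env"
    show "env_gen (Inr i) (Inr j) * (env_gen (Inr k) (Inr l) * x)
        - env_gen (Inr k) (Inr l) * (env_gen (Inr i) (Inr j) * x)
        = (if j = k then env_gen (Inr i) (Inr l) * x else 0)
          - (if i = l then env_gen (Inr k) (Inr j) * x else 0)"
      using arg_cong[OF env_gen_bracket[of "Inr i" "Inr j" "Inr k" "Inr l"], of "\<lambda>z. z * x"]
      by (simp add: flip_def left_diff_distrib mult.assoc split: if_splits)
  qed (simp_all add: distrib_left)
qed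

text \<open>The enveloping algebra itself serves as the \<open>gl(n)\<close>-module \<open>V\<close>: on the vacuum vector of \<open>1\<close>, an
  element \<open>x\<close> of \<open>env_gl\<close> gives the vacuum vector of \<open>x\<close>, while an element of \<open>Irr\<close> gives zero.\<close>

lemma env_gl_Irr_zero:
  fixes x :: "('m::finite, 'n::finite) env"
  assumes "x \<in> env_gl" "x \<in> Irr"
  shows "x = 0"
proof -
  interpret R: gl_rep "\<lambda>c x :: ('m, 'n) env. env_scalar c * x"
      "\<lambda>i j x. env_gen (Inr i) (Inr j) * x"
    by (rule env_left_regular)
  have act: "app (R.act x) (vac y) = vac (x * y)" for y
    using assms(1)
  proof (induction arbitrary: y)
    case (add x x')
    then show ?case by (simp add: distrib_right R.vac_add)
  qed (simp_all add: R.scalar_vac R.proper_op_vac mult.assoc)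
  have "vac x = (vac 0 :: ('m \<times> 'n) set \<Rightarrow> ('m, 'n) env)"
    using act[of 1] R.Irr_kills[OF assms(2), of 1] by (simp add: vac_def fun_eq_iff)
  then show ?thesis by (metis vac_def)
qed

lemma Irr_diff: "x \<in> Irr \<Longrightarrow> y \<in> Irr \<Longrightarrow> x - y \<in> Irr"
  unfolding Irr_def by (rule left_ideal_gen_diff)

lemma env_gl_diff: "x \<in> env_gl \<Longrightarrow> y \<in> env_gl \<Longrightarrow> x - y \<in> env_gl"
  using env_gl.add[of x "env_scalar (-1) * y"] env_gl.mult[OF env_gl.scalar[of "-1"], of y]
  by (simp add: env_scalar_uminus)

text \<open>Since \<open>env_gl\<close> and \<open>Irr\<close> meet only in \<open>0\<close>, the description in \<open>devirt\<close> picks out \<open>u\<close>.\<close>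

lemma devirt_eq:
  fixes x :: "('m::finite, 'n::finite) env"
  assumes u: "u \<in> env_gl" "x - u \<in> Irr"
  shows "devirt x = u"
  unfolding devirt_def
proof (rule the_equality)
  fix w assume w: "w \<in> env_gl \<and> x - w \<in> Irr"
  then have "(x - u) - (x - w) \<in> Irr" using u(2) by (blast intro: Irr_diff)
  then have "w - u \<in> Irr" by simp
  moreover have "w - u \<in> env_gl" using u w by (intro env_gl_diff) auto
  ultimately show "w = u" using env_gl_Irr_zero by force
qed (use u in auto)

lemma devirt_balanced_word:
  fixes ss ts :: "('n::finite \<times> 'm::finite) list"
  defines "x \<equiv> env_word (map (\<lambda>(s, a). (Inr s, Inl a)) ss)
      * env_word (map (\<lambda>(t, a). (Inl a, Inr t)) ts)"
  assumes "length ss = length ts"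
  shows "devirt x \<in> env_gl" "x - devirt x \<in> Irr"
  using balanced_word_decomposition[OF assms(2)] virtual_ideal_Irr devirt_eq
  unfolding x_def by blast+

section \<open>Evaluation on a highest weight vector\<close>

lemma ann_ann_same: "ann a * ann a = 0"
  by (rule endo_eqI) (auto simp: ann.rep_eq flip_def fun_eq_iff)

lemma cre_cre_same: "cre a * cre a = 0"
  by (rule endo_eqI) (auto simp: cre.rep_eq flip_def fun_eq_iff)

lemma app_cong: "A = B \<Longrightarrow> app A f = app B f"
  by simp

lemmas app_ann_ann = ann_ann[THEN app_cong, unfolded app_arith]
  and app_cre_cre = cre_cre[THEN app_cong, unfolded app_arith]

lemma app_ann_cre: "app (ann a) (app (cre b) f) = (if a = b then f else 0) - app (cre b) (app (ann a) f)"
  using ann_cre[of a b, THEN app_cong, of f] by (simp split: if_splits)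

lemma app_cre_ann: "app (cre b) (app (ann a) f) = (if a = b then f else 0) - app (ann a) (app (cre b) f)"
  using app_ann_cre[of a b f] by (simp add: algebra_simps)

locale highest_weight = gl_rep scal E
  for scal :: "complex \<Rightarrow> 'v::ab_group_add \<Rightarrow> 'v"
    and E :: "'n::{finite,linorder} \<Rightarrow> 'n \<Rightarrow> 'v \<Rightarrow> 'v" +
  fixes mu :: "'n \<Rightarrow> complex" and v :: 'v
  assumes raising: "i < j \<Longrightarrow> E i j v = 0"
    and weight: "E i i v = scal (mu i) v"
begin

text \<open>The vectors met in the computation are, up to sign, monomials in the odd variables of \<open>S\<close> with
  coefficient \<open>v\<close>. What matters about such a monomial is that multiplication by a variable of \<open>S\<close>
  kills it, that differentiation by any other variable kills it, and that its coefficient is a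
  highest weight vector; this form avoids all signs.\<close>

definition occupied :: "('m::finite \<times> 'n) set \<Rightarrow> (('m \<times> 'n) set \<Rightarrow> 'v) \<Rightarrow> bool" where
  "occupied S f \<longleftrightarrow> (\<forall>a. if a \<in> S then app (cre a) f = 0 else app (ann a) f = 0) \<and>
     (\<forall>i j. i < j \<longrightarrow> app (coeff_E i j) f = 0) \<and>
     (\<forall>i. app (coeff_E i i) f = app (scalar (mu i)) f)"

lemma occupied_in: "occupied S f \<Longrightarrow> a \<in> S \<Longrightarrow> app (cre a) f = 0"
  and occupied_out: "occupied S f \<Longrightarrow> a \<notin> S \<Longrightarrow> app (ann a) f = 0"
  and occupied_raising: "occupied S f \<Longrightarrow> i < j \<Longrightarrow> app (coeff_E i j) f = 0"
  and occupied_weight: "occupied S f \<Longrightarrow> app (coeff_E i i) f = app (scalar (mu i)) f"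
  unfolding occupied_def by metis+

lemma occupied_vac: "occupied {} (vac v)"
  by (auto simp: occupied_def ann_vac coeff_E_def coeffwise_vac additive_E raising weight scalar_vac
      vac_def fun_eq_iff)

lemma app_coeff_E_cre: "app (coeff_E i j) (app (cre a) f) = app (cre a) (app (coeff_E i j) f)"
  and app_coeff_E_ann: "app (coeff_E i j) (app (ann a) f) = app (ann a) (app (coeff_E i j) f)"
  and app_scalar_cre: "app (scalar c) (app (cre a) f) = app (cre a) (app (scalar c) f)"
  and app_scalar_ann: "app (scalar c) (app (ann a) f) = app (ann a) (app (scalar c) f)"
  using coeff_E_cre[of i j a, THEN app_cong, of f] coeff_E_ann[of i j a, THEN app_cong, of f]
    scalar_cre[of c a, THEN app_cong, of f] scalar_ann[of c a, THEN app_cong, of f]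
  by (simp_all add: comm_def)

lemma occupied_ann:
  assumes "occupied S f" "a \<in> S"
  shows "occupied (S - {a}) (app (ann a) f)"
proof -
  have "if b \<in> S - {a} then app (cre b) (app (ann a) f) = 0 else app (ann b) (app (ann a) f) = 0" for b
  proof (cases "b = a")
    case True
    then show ?thesis using ann_ann_same[of a, THEN app_cong, of f] by simp
  next
    case False
    then show ?thesis
      using app_cre_ann[of b a f] app_ann_ann[of b a f] assms(1)
      by (cases "b \<in> S") (simp_all add: occupied_in occupied_out app_arith_right)
  qed
  with assms show ?thesis
    unfolding occupied_def app_coeff_E_ann app_scalar_ann by (simp add: app_arith_right)
qed

lemma occupied_cre:
  assumes "occupied S f" "a \<notin> S"
  shows "occupied (insert a S) (app (cre a) f)"
proof -
  have "if b \<in> insert a S then app (cre b) (app (cre a) f) = 0 else app (ann b) (app (cre a) f) = 0" for b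
  proof (cases "b = a")
    case True
    then show ?thesis using cre_cre_same[of a, THEN app_cong, of f] by simp
  next
    case False
    then show ?thesis
      using app_ann_cre[of b a f] app_cre_cre[of b a f] assms(1)
      by (cases "b \<in> S") (simp_all add: occupied_in occupied_out app_arith_right)
  qed
  with assms show ?thesis
    unfolding occupied_def app_coeff_E_cre app_scalar_cre by (simp add: app_arith_right)
qed

lemma scalar_diff: "scalar (c - d) = scalar c - scalar d"
  using scalar_add[of c "- d"] by (simp add: scalar_uminus)

lemma app_scalar_scalar: "app (scalar c) (app (scalar d) f) = app (scalar (c * d)) f"
  by (simp add: scalar_mult)

lemma scalar_sum: "scalar (\<Sum>i\<in>I. c i) = (\<Sum>i\<in>I. scalar (c i))"
  by (induction I rule: infinite_finite_induct) (simp_all add: scalar_add)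

text \<open>The source of the factors of the eigenvalue. Write \<open>e_{i,\<alpha>}\<close> as the sum over \<open>j\<close> of
  \<open>e_{i,j} ann (\<alpha>, j)\<close>. Terms with \<open>j < i\<close> vanish since \<open>(\<alpha>, j)\<close> is unoccupied. In the others
  \<open>e_{i,j}\<close> is moved to the right, which costs \<open>ann (\<alpha>, i)\<close> each time and accounts for
  \<open>card {i..}\<close>. After that, \<open>e_{i,j}\<close> with \<open>j > i\<close> kills \<open>f\<close>: its matrix part raises, and its
  derivation part replaces a variable by one that is present already. Finally \<open>e_{i,i}\<close>
  multiplies \<open>f\<close> by \<open>\<mu>_i\<close> minus the number of occupied cells in column \<open>i\<close>.\<close>

lemma lowering_occupied:
  assumes occ: "occupied S f"
    and right: "\<And>\<gamma> j. (\<gamma>, i) \<in> S \<Longrightarrow> i < j \<Longrightarrow> (\<gamma>, j) \<in> S"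
    and left: "\<And>j. j < i \<Longrightarrow> (\<alpha>, j) \<notin> S"
  shows "app (lowering_op i \<alpha>) f =
    app (scalar (mu i - of_nat (card {\<gamma>. (\<gamma>, i) \<in> S}) + of_nat (card {i..}))) (app (ann (\<alpha>, i)) f)"
proof -
  let ?k = "of_nat (card {\<gamma>. (\<gamma>, i) \<in> S}) :: complex"
  let ?c = "\<lambda>j. (if i \<le> j then 1 else 0) + (if j = i then mu i - ?k else 0)"
  \<comment> \<open>The number operator of a cell, which reads off its occupation.\<close>
  have number: "app (cre (\<gamma>, i)) (app (ann (\<gamma>, i)) f) = (if (\<gamma>, i) \<in> S then f else 0)" for \<gamma>
    using app_cre_ann[of "(\<gamma>, i)" "(\<gamma>, i)" f] occ
    by (cases "(\<gamma>, i) \<in> S") (simp_all add: occupied_in occupied_out app_arith_right)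
  have shift: "app (cre (\<gamma>, j)) (app (ann (\<gamma>, i)) f) = 0" if "i < j" for \<gamma> j
    using occ that right[of \<gamma> j] app_cre_ann[of "(\<gamma>, j)" "(\<gamma>, i)" f] less_imp_neq[OF that]
    by (cases "(\<gamma>, i) \<in> S") (simp_all add: occupied_in occupied_out app_arith_right)
  have proper_diag: "app (proper_op i i) f = app (scalar (mu i - ?k)) f"
  proof -
    have "(\<Sum>\<gamma>\<in>UNIV. if (\<gamma>, i) \<in> S then f else 0) = (\<Sum>\<gamma>\<in>{\<gamma>. (\<gamma>, i) \<in> S}. f)"
      by (intro sum.mono_neutral_cong_right) auto
    also have "\<dots> = app (scalar ?k) f"
    proof -
      have "?k = (\<Sum>\<gamma>\<in>{\<gamma>. (\<gamma>, i) \<in> S}. 1)" by simp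
      then show ?thesis by (simp only: scalar_sum app_sum scalar_1 app_arith)
    qed
    finally show ?thesis
      using occ by (simp add: proper_op_def app_sum number occupied_weight scalar_diff)
  qed
  have proper_above: "app (proper_op i j) f = 0" if "i < j" for j
    using occ that by (simp add: proper_op_def app_sum shift occupied_raising)
  have "app (proper_op i j) (app (ann (\<alpha>, j)) f) = app (scalar (?c j)) (app (ann (\<alpha>, i)) f)" for j
  proof -
    have push: "app (proper_op i j) (app (ann (\<alpha>, j)) f) =
        app (ann (\<alpha>, j)) (app (proper_op i j) f) + app (ann (\<alpha>, i)) f"
      using proper_ann[of i j \<alpha> j, THEN app_cong, of f] by (simp add: comm_def algebra_simps)
    consider "j < i" | "j = i" | "i < j" by (rule linorder_cases)
    then show ?thesis
    proof cases
      case 1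
      then have "app (ann (\<alpha>, j)) f = 0" using occ left by (auto simp: occupied_def)
      with 1 show ?thesis by (auto simp: app_arith_right)
    next
      case 2
      show ?thesis
        using push unfolding 2 by (simp add: proper_diag app_scalar_ann scalar_add add.commute)
    next
      case 3
      then show ?thesis using less_imp_le[OF 3] less_imp_neq[OF 3]
        by (simp add: push proper_above app_arith_right)
    qed
  qed
  then have "app (lowering_op i \<alpha>) f = app (scalar (\<Sum>j\<in>UNIV. ?c j)) (app (ann (\<alpha>, i)) f)"
    by (simp add: lowering_op_def app_sum scalar_sum)
  moreover have "(\<Sum>j\<in>UNIV. ?c j) = mu i - ?k + of_nat (card {i..})"
  proof -
    have "(\<Sum>j\<in>UNIV. if i \<le> j then 1 else 0 :: complex) = (\<Sum>j\<in>{i..}. 1)"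
      by (intro sum.mono_neutral_cong_right) auto
    then show ?thesis by (simp add: sum.distrib)
  qed
  ultimately show ?thesis by simp
qed

definition creations :: "('m::finite \<times> 'n) list \<Rightarrow> (('m \<times> 'n) set \<Rightarrow> 'v) endo"
  where "creations as = prod_list (map cre as)"

definition annihilations :: "('m::finite \<times> 'n) list \<Rightarrow> (('m \<times> 'n) set \<Rightarrow> 'v) endo"
  where "annihilations as = prod_list (map ann as)"

definition lowerings :: "('m::finite \<times> 'n) list \<Rightarrow> (('m \<times> 'n) set \<Rightarrow> 'v) endo"
  where "lowerings as = prod_list (map (\<lambda>(\<alpha>, i). lowering_op i \<alpha>) as)"

lemma op_list_simps [simp]:
  "creations [] = 1" "creations (a # as) = cre a * creations as"
  "creations (as @ bs) = creations as * creations bs"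
  "annihilations [] = 1" "annihilations (a # as) = ann a * annihilations as"
  "annihilations (as @ bs) = annihilations as * annihilations bs"
  "lowerings [] = 1" "lowerings ((\<alpha>, i) # as) = lowering_op i \<alpha> * lowerings as"
  "lowerings (as @ bs) = lowerings as * lowerings bs"
  by (simp_all add: creations_def annihilations_def lowerings_def)

lemma app_scalar_lowering:
  "app (lowering_op i \<alpha>) (app (scalar c) f) = app (scalar c) (app (lowering_op i \<alpha>) f)"
  using scalar_kac[of c "Inr i" "Inl \<alpha>", THEN app_cong, of f] by simp

lemma app_scalar_lowerings:
  "app (lowerings as) (app (scalar c) f) = app (scalar c) (app (lowerings as) f)"
  by (induction as) (auto simp: app_scalar_lowering)

lemma occupied_creations:
  "occupied S f \<Longrightarrow> distinct as \<Longrightarrow> set as \<inter> S = {} \<Longrightarrow> occupied (set as \<union> S) (app (creations as) f)"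
  by (induction as) (auto intro!: occupied_cre)

lemma ann_creations:
  "a \<notin> set bs \<Longrightarrow>
     app (ann a) (app (creations bs) f) = app (scalar ((-1) ^ length bs)) (app (creations bs) (app (ann a) f))"
  by (induction bs) (auto simp: app_ann_cre app_scalar_cre scalar_uminus)

lemma annihilations_creations_disjoint:
  "set as \<inter> set bs = {} \<Longrightarrow>
     app (annihilations as) (app (creations bs) f) =
     app (scalar ((-1) ^ (length as * length bs))) (app (creations bs) (app (annihilations as) f))"
proof (induction as)
  case (Cons a as)
  then show ?case
    by (simp add: ann_creations app_scalar_ann[symmetric] power_add app_scalar_scalar mult.commute)
qed simp

lemma annihilations_rev_creations:
  "distinct as \<Longrightarrow> (\<And>a. a \<in> set as \<Longrightarrow> app (ann a) f = 0) \<Longrightarrow>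
     app (annihilations (rev as)) (app (creations as) f) = f"
proof (induction as)
  case (Cons a as)
  have "a \<notin> set as" "app (ann a) f = 0"
    using Cons.prems by auto
  then have "app (ann a) (app (creations as) f) = 0"
    using ann_creations[of a as f] by (simp add: app_arith_right)
  moreover have "app (annihilations (rev as)) (app (creations as) f) = f"
    using Cons by auto
  ultimately show ?case by (simp add: app_ann_cre app_arith_right)
qed simp

text \<open>One row of the left half of the bitableau. Its letters act from the right in the order
  \<open>1, 2, \<dots>\<close>, which is the order in which the hypotheses of \<open>lowering_occupied\<close> stay true: the part
  of row \<open>\<alpha>\<close> that is still occupied is always a final segment. Each letter acts as \<open>ann\<close> up to a
  scalar, so the whole row acts as a product of annihilators.\<close>

lemma lowerings_row:
  assumes occ: "occupied (A \<times> UNIV) f" and \<alpha>: "\<alpha> \<in> A"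
    and split: "rev (sorted_list_of_set (UNIV :: 'n set)) = ys @ zs"
  shows "app (lowerings (map (Pair \<alpha>) zs)) f =
      app (scalar (\<Prod>i\<leftarrow>zs. mu i - of_nat (card A) + of_nat (card {i..})))
        (app (annihilations (map (Pair \<alpha>) zs)) f)
    \<and> occupied (A \<times> UNIV - {\<alpha>} \<times> set zs) (app (annihilations (map (Pair \<alpha>) zs)) f)"
  using split
proof (induction zs arbitrary: ys)
  case Nil
  then show ?case using occ by simp
next
  case (Cons z zs)
  let ?g = "app (annihilations (map (Pair \<alpha>) zs)) f" and ?S = "A \<times> UNIV - {\<alpha>} \<times> set zs"
  let ?c = "\<Prod>i\<leftarrow>zs. mu i - of_nat (card A) + of_nat (card {i..})"
  have IH: "app (lowerings (map (Pair \<alpha>) zs)) f = app (scalar ?c) ?g" "occupied ?S ?g"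
    using Cons.IH[of "ys @ [z]"] Cons.prems by auto
  have "sorted_wrt (\<lambda>x y. y < x) (rev (sorted_list_of_set (UNIV :: 'n set)))"
    by (simp add: sorted_wrt_rev)
  then have desc: "\<forall>y\<in>set ys. z < y" "\<forall>y\<in>set zs. y < z"
    unfolding Cons.prems by (auto simp: sorted_wrt_append)
  have all: "set ys \<union> {z} \<union> set zs = UNIV"
    using arg_cong[OF Cons.prems, of set] by auto
  have "app (lowering_op z \<alpha>) ?g =
      app (scalar (mu z - of_nat (card {\<gamma>. (\<gamma>, z) \<in> ?S}) + of_nat (card {z..}))) (app (ann (\<alpha>, z)) ?g)"
  proof (rule lowering_occupied[OF IH(2)])
    fix j assume "j < z"
    then have "j \<in> set zs" using all desc by fastforce
    then show "(\<alpha>, j) \<notin> ?S" by simp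
  qed (use desc in auto)
  moreover have "{\<gamma>. (\<gamma>, z) \<in> ?S} = A" using desc by auto
  moreover have "occupied (?S - {(\<alpha>, z)}) (app (ann (\<alpha>, z)) ?g)"
    by (rule occupied_ann[OF IH(2)]) (use desc \<alpha> in auto)
  moreover have "?S - {(\<alpha>, z)} = A \<times> UNIV - {\<alpha>} \<times> set (z # zs)" by auto
  ultimately show ?case
    using IH(1)
    by (simp add: app_scalar_lowering app_scalar_scalar mult.commute)
qed

text \<open>The cells of a tableau whose rows are indexed by virtual symbols and all carry the word \<open>r\<close>, in
  the order of reading.\<close>

definition cells :: "'m list \<Rightarrow> 'n list \<Rightarrow> ('m \<times> 'n) list"
  where "cells alphas r = concat (map (\<lambda>\<alpha>. map (Pair \<alpha>) r) alphas)"

lemma cells_simps [simp]: "cells [] r = []" "cells (as @ bs) r = cells as r @ cells bs r"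
  "cells [\<alpha>] r = map (Pair \<alpha>) r" "set (cells as r) = set as \<times> set r"
  "length (cells as r) = length as * length r"
  by (induction as) (auto simp: cells_def)

lemma distinct_cells: "distinct as \<Longrightarrow> distinct r \<Longrightarrow> distinct (cells as r)"
  by (induction as) (auto simp: cells_def distinct_map inj_on_def)

abbreviation columns :: "'n list"
  where "columns \<equiv> sorted_list_of_set UNIV"

text \<open>The last row of the left half removes the last row of the right half and returns the product
  for one row less. With \<open>k\<close> other rows, its \<open>n\<close> annihilators pass \<open>k n\<close> variables, with sign
  \<open>(-1)^(k n n) = (-1)^(k n)\<close>; over all rows the exponents add up to \<open>(p choose 2) n\<close>.\<close>

lemma lowerings_creations:
  assumes "distinct alphas"
  shows "app (lowerings (cells alphas (rev columns))) (app (creations (cells alphas columns)) (vac v)) =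
    app (scalar ((-1) ^ ((length alphas choose 2) * CARD('n)) *
      (\<Prod>k=1..length alphas. \<Prod>i\<in>UNIV. mu i - of_nat k + of_nat (card {i..})))) (vac v)"
  using assms
proof (induction alphas rule: rev_induct)
  case Nil
  then show ?case by (simp add: numeral_2_eq_2)
next
  case (snoc \<alpha> alphas)
  let ?n = "CARD('n)" and ?k = "length alphas"
  let ?C = "\<lambda>as. creations (cells as columns)" and ?row = "map (Pair \<alpha>) columns"
  let ?f = "app (?C (alphas @ [\<alpha>])) (vac v)"
  let ?c = "\<Prod>i\<in>UNIV. mu i - of_nat (Suc ?k) + of_nat (card {i..})"
  have len: "length columns = ?n" by simp
  have occ: "occupied (set (alphas @ [\<alpha>]) \<times> UNIV) ?f"
  proof -
    have "set (cells (alphas @ [\<alpha>]) columns) = set (alphas @ [\<alpha>]) \<times> UNIV"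
      unfolding cells_simps(4) by simp
    moreover have "occupied (set (cells (alphas @ [\<alpha>]) columns) \<union> {}) ?f"
      by (rule occupied_creations[OF occupied_vac distinct_cells[OF snoc.prems]]) simp_all
    ultimately show ?thesis by (simp only: Un_empty_right)
  qed
  have card: "card (set (alphas @ [\<alpha>])) = Suc ?k"
    using distinct_card[OF snoc.prems] by simp
  have "(\<Prod>i\<leftarrow>rev columns. mu i - of_nat (Suc ?k) + of_nat (card {i..})) = ?c"
    by (subst prod.distinct_set_conv_list[symmetric]) simp_all
  then have "app (lowerings (map (Pair \<alpha>) (rev columns))) ?f =
      app (scalar ?c) (app (annihilations (map (Pair \<alpha>) (rev columns))) ?f)"
    using conjunct1[OF lowerings_row[OF occ _ append_Nil[symmetric], of \<alpha>]]
    unfolding card by simp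
  \<comment> \<open>The annihilators of the last row pass all other rows and then cancel the row that they match.\<close>
  also have "app (annihilations (map (Pair \<alpha>) (rev columns))) ?f =
      app (scalar ((-1) ^ (?n * (?k * ?n)))) (app (?C alphas) (vac v))"
  proof -
    have "app (annihilations (rev ?row)) (app (creations ?row) (vac v)) = vac v"
      by (rule annihilations_rev_creations) (auto simp: distinct_map inj_on_def ann_vac)
    moreover have "set (rev ?row) \<inter> set (cells alphas columns) = {}"
      using snoc.prems by auto
    ultimately show ?thesis
      using annihilations_creations_disjoint[of "rev ?row" "cells alphas columns" "app (creations ?row) (vac v)"]
      by (simp add: rev_map len)
  qed
  finally have row: "app (lowerings (map (Pair \<alpha>) (rev columns))) ?f =
      app (scalar (?c * (-1) ^ (?n * ?k))) (app (?C alphas) (vac v))"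
    by (simp add: app_scalar_scalar minus_one_power_iff)
  have "app (lowerings (cells (alphas @ [\<alpha>]) (rev columns))) ?f =
      app (scalar (?c * (-1) ^ (?n * ?k))) (app (lowerings (cells alphas (rev columns))) (app (?C alphas) (vac v)))"
    using row by (simp add: app_scalar_lowerings)
  also have "\<dots> = app (scalar (?c * (-1) ^ (?n * ?k))) (app (scalar ((-1) ^ ((?k choose 2) * ?n) *
      (\<Prod>k=1..?k. \<Prod>i\<in>UNIV. mu i - of_nat k + of_nat (card {i..})))) (vac v))"
    using snoc by simp
  also have "\<dots> = app (scalar ((-1) ^ ((Suc ?k choose 2) * ?n) *
      (\<Prod>k=1..Suc ?k. \<Prod>i\<in>UNIV. mu i - of_nat k + of_nat (card {i..})))) (vac v)"
  proof -
    have "(Suc ?k choose 2) * ?n = (?k choose 2) * ?n + ?n * ?k"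
      by (simp add: numeral_2_eq_2 algebra_simps)
    then show ?thesis
      by (simp add: app_scalar_scalar power_add mult_ac del: of_nat_Suc)
  qed
  finally show ?case by simp
qed

lemma bitableau_words:
  fixes alphas :: "'m::finite list"
  assumes "length alphas = p"
  shows "concat (map2 (\<lambda>a row. map (\<lambda>s. (Inr s, Inl a)) row) alphas (replicate p r)) =
      map (\<lambda>(s, a). (Inr s, Inl a)) (map prod.swap (cells alphas r))"
    "concat (map2 (\<lambda>a row. map (\<lambda>t. (Inl a, Inr t)) row) alphas (replicate p r)) =
      map (\<lambda>(t, a). (Inl a, Inr t)) (map prod.swap (cells alphas r))"
  using assms
  by (induction alphas arbitrary: p; force simp: cells_def)+

lemma word_op_cells:
  "word_op (map (\<lambda>(s, a). (Inr s, Inl a)) (map prod.swap as)) = lowerings as"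
  "word_op (map (\<lambda>(t, a). (Inl a, Inr t)) (map prod.swap as)) = creations as"
  by (induction as) auto

text \<open>A bitableau and its devirtualization differ by an element of \<open>Irr\<close>, which annihilates the
  vacuum vectors, so the virtual word can be evaluated instead.\<close>

lemma capelli_deruyts_vac:
  fixes alphas :: "'m::finite list"
  assumes "distinct alphas" "length alphas = p"
  defines "K \<equiv> capelli_deruyts alphas p :: ('m, 'n) env"
  shows "K \<in> env_gl"
    and "app (act K) (vac v) = app (scalar ((-1) ^ ((p choose 2) * CARD('n)) *
      (\<Prod>k=1..p. \<Prod>i\<in>UNIV. mu i - of_nat k + of_nat (card {i..})))) (vac v)"
proof -
  let ?ss = "map prod.swap (cells alphas (rev columns))" and ?ts = "map prod.swap (cells alphas columns)"
  let ?X = "env_word (map (\<lambda>(s, a). (Inr s, Inl a)) ?ss)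
    * env_word (map (\<lambda>(t, a). (Inl a, Inr t)) ?ts) :: ('m, 'n) env"
  have K: "K = devirt ?X"
    unfolding K_def capelli_deruyts_def capelli_bitableau_def
    by (simp only: bitableau_words[OF assms(2)])
  have lens: "length ?ss = length ?ts" by simp
  show "K \<in> env_gl" unfolding K by (rule devirt_balanced_word[OF lens])
  have "?X - K \<in> Irr" unfolding K by (rule devirt_balanced_word[OF lens])
  from Irr_kills[OF this, of v] act_add[of "?X - K" K]
  have "app (act K) (vac v) = app (act ?X) (vac v)" by simp
  also have "\<dots> = app (lowerings (cells alphas (rev columns))) (app (creations (cells alphas columns)) (vac v))"
    by (simp only: act_mult act_word word_op_cells app_arith)
  finally show "app (act K) (vac v) = app (scalar ((-1) ^ ((p choose 2) * CARD('n)) *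
      (\<Prod>k=1..p. \<Prod>i\<in>UNIV. mu i - of_nat k + of_nat (card {i..})))) (vac v)"
    using lowerings_creations[OF assms(1)] assms(2) by simp
qed

end

section \<open>Passage to modules\<close>

lemma elem_mat_mult: "elem_mat i j ** elem_mat k l = (if j = k then elem_mat i l else 0)"
proof -
  have entry: "elem_mat i j $ a $ b = (if a = i \<and> b = j then 1 else 0)" for i j a b :: 'a
    by (simp add: elem_mat_def axis_def)
  have "(\<Sum>c\<in>UNIV. elem_mat i j $ a $ c * elem_mat k l $ c $ b) =
      (\<Sum>c\<in>UNIV. if c = j then (if a = i \<and> j = k \<and> b = l then 1 else 0) else 0)" for a b
    by (rule sum.cong) (auto simp: entry)
  then show ?thesis
    by (auto simp: vec_eq_iff matrix_matrix_mult_def entry)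
qed

lemma (in gl_module) gl_rep_elem_mat: "gl_rep smul (\<lambda>i j. rho (elem_mat i j))"
proof
  fix i j k l x
  have zero: "rho 0 y = 0" for y using rho_add[of 0 0 y] by simp
  have diff: "rho (A - B) y = rho A y - rho B y" for A B y
    using rho_add[of "A - B" B y] by (simp add: algebra_simps)
  show "rho (elem_mat i j) (rho (elem_mat k l) x) - rho (elem_mat k l) (rho (elem_mat i j) x)
      = (if j = k then rho (elem_mat i l) x else 0) - (if i = l then rho (elem_mat k j) x else 0)"
    unfolding rho_bracket[symmetric] elem_mat_mult diff by (auto simp: zero)
qed (auto intro: module_hom.add module_hom.scale rho_linear[THEN Vector_Spaces.linear.axioms(3)])

text \<open>\<open>env_gl_act\<close> refers to an extension of \<open>rho\<close> to \<open>env_gl\<close>. The action on the vacuum vectors of the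
  Kac module is one; any two agree on \<open>env_gl\<close>, since they agree on its generators.\<close>

lemma (in gl_rep) env_gl_act_eq:
  fixes x :: "('m::finite, 'n) env"
  assumes E: "\<And>i j. E i j = rho (elem_mat i j)"
    and x: "x \<in> env_gl" and w: "app (act x) (vac y) = vac w"
  shows "env_gl_act scal rho x y = w"
proof -
  define Phi where "Phi z y = app (act z) (vac y) {}" for z :: "('m, 'n) env" and y
  have vac_empty: "vac y {} = y" for y :: 'v by (simp add: vac_def)
  have stays: "app (act z) (vac y) = vac (Phi z y)" if "z \<in> env_gl" for z :: "('m, 'n) env" and y
    using act_gl_vac[OF that, of y] by (auto simp: Phi_def vac_empty)
  have extends: "extends_to_env_gl scal rho Phi"
    unfolding extends_to_env_gl_def
  proof (intro conjI ballI allI)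
    fix z :: "('m, 'n) env" assume "z \<in> env_gl"
    show "Vector_Spaces.linear scal scal (Phi z)"
    proof (unfold_locales)
      fix a b :: 'v and c
      show "Phi z (a + b) = Phi z a + Phi z b"
        by (simp add: Phi_def vac_add app_add_right)
      have "app (act z) (vac (scal c a)) = app (act (z * env_scalar c)) (vac a)"
        by (simp add: scalar_vac)
      also have "\<dots> = app (scalar c) (app (act z) (vac a))"
        by (simp add: env_scalar_central)
      finally show "Phi z (scal c a) = scal c (Phi z a)"
        by (simp add: Phi_def app_scalar)
    qed
  next
    fix z z' :: "('m, 'n) env" and y assume "z \<in> env_gl" "z' \<in> env_gl"
    then show "Phi (z * z') y = Phi z (Phi z' y)"
      by (simp add: Phi_def[of "z * z'"] stays vac_empty)
  qed (simp_all add: Phi_def scalar_vac proper_op_vac E vac_empty)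
  have unique: "Phi' z y = Phi z y"
    if ext: "extends_to_env_gl scal rho Phi'" and "z \<in> env_gl" for Phi' and z :: "('m, 'n) env" and y
    using that(2)
  proof (induction arbitrary: y)
    case (scalar c)
    show ?case using ext extends by (simp add: extends_to_env_gl_def)
  next
    case (gen i j)
    show ?case using ext extends by (simp add: extends_to_env_gl_def)
  next
    case (add z z')
    then show ?case using ext extends by (simp add: extends_to_env_gl_def)
  next
    case (mult z z')
    then show ?case using ext extends by (simp add: extends_to_env_gl_def)
  qed
  have "env_gl_act scal rho x y = Phi x y"
    unfolding env_gl_act_def
  proof (rule the_equality)
    show "\<exists>Phi'. extends_to_env_gl scal rho Phi' \<and> Phi x y = Phi' x y"
      using extends by blast
  next
    fix w' assume "\<exists>Phi'. extends_to_env_gl scal rho Phi' \<and> w' = Phi' x y"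
    then show "w' = Phi x y" using unique[OF _ x] by blast
  qed
  with w show ?thesis by (simp add: Phi_def vac_empty)
qed

lemma card_atLeast_pos: "of_nat (card {i..}) = of_nat CARD('n) - of_nat (pos i) + (1::complex)"
  for i :: "'n::{finite,linorder}"
proof -
  have "card {..i} + card {i..} = card (UNIV :: 'n set) + card {i}"
  proof -
    have "{..i} \<union> {i..} = UNIV" "{..i} \<inter> {i..} = {i}" by auto
    then show ?thesis using card_Un_Int[of "{..i}" "{i..}"] by simp
  qed
  then have "of_nat (card {..i}) + of_nat (card {i..}) = (of_nat CARD('n) + 1 :: complex)"
    unfolding of_nat_add[symmetric] by simp
  then show ?thesis by (simp add: pos_def algebra_simps)
qed

theorem theorem1:
  fixes smul :: "complex \<Rightarrow> 'v::ab_group_add \<Rightarrow> 'v"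
    and rho :: "complex ^ 'n::{finite,linorder} ^ 'n::{finite,linorder} \<Rightarrow> 'v \<Rightarrow> 'v"
    and mu :: "'n \<Rightarrow> nat"
    and v :: 'v
    and p :: nat
    and alphas :: "'m::finite list"
  assumes "p > 0"
    and "length alphas = p"
    and "distinct alphas"
    and "gl_module smul rho"
    and "antimono mu"
    and "highest_weight_vector smul rho (\<lambda>i. of_nat (mu i)) v"
  shows "env_gl_act smul rho (capelli_deruyts alphas p :: ('m, 'n) env) v =
    smul ((-1) ^ ((p choose 2) * CARD('n)) *
      (\<Prod>j = 1..p. \<Prod>i\<in>UNIV. of_nat (mu i) - of_nat j + of_nat CARD('n) - of_nat (pos i) + 1)) v"
proof -
  interpret M: gl_module smul rho by fact
  interpret R: gl_rep smul "\<lambda>i j. rho (elem_mat i j)" by (rule M.gl_rep_elem_mat)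
  interpret H: highest_weight smul "\<lambda>i j. rho (elem_mat i j)" "\<lambda>i. of_nat (mu i)" v
    using assms(6) by unfold_locales (auto simp: highest_weight_vector_def)
  have "app (R.act (capelli_deruyts alphas p :: ('m, 'n) env)) (vac v) =
      vac (smul ((-1) ^ ((p choose 2) * CARD('n)) *
        (\<Prod>j = 1..p. \<Prod>i\<in>UNIV. of_nat (mu i) - of_nat j + of_nat (card {i..}))) v)"
    using H.capelli_deruyts_vac(2)[OF assms(3,2)] by (simp add: R.scalar_vac)
  note R.env_gl_act_eq[OF refl H.capelli_deruyts_vac(1)[OF assms(3,2)] this]
  moreover have "of_nat (mu i) - of_nat j + of_nat (card {i..}) =
      (of_nat (mu i) - of_nat j + of_nat CARD('n) - of_nat (pos i) + 1 :: complex)" for i j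
    by (simp add: card_atLeast_pos)
  ultimately show ?thesis by simp
qed

end
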